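(* Let $\Lambda=\{1,\ldots,N_s\}$ with $N_s$ even and periodic boundary conditions ($N_s+x$ identified with $x$), $t>0$, $t'>0$, and $$H=-t\sum_{x=1}^{N_s}\sum_{\sigma}(c^\dagger_{x,\sigma}c_{x+1,\sigma}+c^\dagger_{x+1,\sigma}c_{x,\sigma})+t'\sum_{j=1}^{N_s/2}\sum_{\sigma}(c^\dagger_{2j,\sigma}c_{2j+2,\sigma}n_{2j+1}+c^\dagger_{2j+2,\sigma}c_{2j,\sigma}n_{2j+1})+U\sum_{x=1}^{N_s}n_{x,\uparrow}n_{x,\downarrow}.$$ In the limit $U=\infty$ and for any odd electron number $N_e$ (necessarily $N_e<N_s$), the ground states have total spin $S_{\rm tot}=S_{\max}=N_e/2$ and are nondegenerate apart from the trivial $(2S_{\max}+1)$-fold degeneracy.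
   Context: $c_{x,\sigma}$ are fermion annihilation operators ($x\in\Lambda$, $\sigma\in\{\uparrow,\downarrow\}$) with canonical anticommutation relations and vacuum $\Phi_{\rm vac}$; $\mathcal H_{N_e}$ is the span of $c^\dagger_{x_1,\sigma_1}\cdots c^\dagger_{x_{N_e},\sigma_{N_e}}\Phi_{\rm vac}$; $n_{x,\sigma}=c^\dagger_{x,\sigma}c_{x,\sigma}$, $n_x=n_{x,\uparrow}+n_{x,\downarrow}$. The $U=\infty$ limit means: with $P_0=\prod_x(1-n_{x,\uparrow}n_{x,\downarrow})$, one studies $P_0H'P_0$ on $P_0\mathcal H_{N_e}$, where $H'$ is $H$ without the $U$ term; ground states are its lowest-eigenvalue eigenvectors. Total spin operators $S^{(\alpha)}_{\rm tot}=\frac12\sum_x\sum_{\sigma,\tau}c^\dagger_{x,\sigma}(p^{(\alpha)})_{\sigma,\tau}c_{x,\tau}$ (Pauli matrices); total spin $S_{\rm tot}$ means $\sum_\alpha(S^{(\alpha)}_{\rm tot})^2=S_{\rm tot}(S_{\rm tot}+1)$ on the state. "Nondegenerate apart from the trivial $(2S_{\max}+1)$-fold degeneracy" means the ground-state eigenspace has dimension exactly $2S_{\max}+1$ and all ground states have $S_{\rm tot}=S_{\max}$. *)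

theory Defs
  imports Complex_Main "HOL-Library.Function_Algebras"
begin

text \<open>Fock space: one-particle orbitals are natural numbers k = 2*x + s, where
  x < Ns is a site (paper site y corresponds to y mod Ns, so site Ns is 0)
  and s = 0 (spin up) or s = 1 (spin down).  A basis vector is a finite set
  of occupied orbitals (ordered by the natural order of nat, which fixes the
  fermionic sign convention); a state is a function from configurations to
  complex amplitudes.\<close>

type_synonym state = "nat set \<Rightarrow> complex"

definition orb :: "nat \<Rightarrow> nat \<Rightarrow> nat" where
  "orb x s = 2 * x + s"

definition smul :: "complex \<Rightarrow> state \<Rightarrow> state" where
  "smul a \<psi> = (\<lambda>S. a * \<psi> S)"

definition fsign :: "nat set \<Rightarrow> nat \<Rightarrow> complex" where
  "fsign S k = (-1) ^ card {j \<in> S. j < k}"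

text \<open>annihilation c_k and creation c_k^dagger; c_k |T> = sign |T - {k}> for k in T\<close>
definition ann :: "nat \<Rightarrow> state \<Rightarrow> state" where
  "ann k \<psi> = (\<lambda>S. if k \<notin> S then fsign S k * \<psi> (insert k S) else 0)"

definition cre :: "nat \<Rightarrow> state \<Rightarrow> state" where
  "cre k \<psi> = (\<lambda>S. if k \<in> S then fsign (S - {k}) k * \<psi> (S - {k}) else 0)"

definition numop :: "nat \<Rightarrow> state \<Rightarrow> state" where
  "numop k \<psi> = cre k (ann k \<psi>)"

definition nsite :: "nat \<Rightarrow> state \<Rightarrow> state" where
  "nsite x \<psi> = numop (orb x 0) \<psi> + numop (orb x 1) \<psi>"

definition Hprime :: "nat \<Rightarrow> real \<Rightarrow> real \<Rightarrow> state \<Rightarrow> state" where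
  "Hprime Ns t t' \<psi> =
     smul (- complex_of_real t)
       (\<Sum>x\<in>{1..Ns}. \<Sum>s\<in>{0,1}.
          cre (orb (x mod Ns) s) (ann (orb ((x+1) mod Ns) s) \<psi>)
        + cre (orb ((x+1) mod Ns) s) (ann (orb (x mod Ns) s) \<psi>))
   + smul (complex_of_real t')
       (\<Sum>j\<in>{1..Ns div 2}. \<Sum>s\<in>{0,1}.
          cre (orb ((2*j) mod Ns) s) (ann (orb ((2*j+2) mod Ns) s) (nsite ((2*j+1) mod Ns) \<psi>))
        + cre (orb ((2*j+2) mod Ns) s) (ann (orb ((2*j) mod Ns) s) (nsite ((2*j+1) mod Ns) \<psi>)))"

definition no_double :: "nat set \<Rightarrow> bool" where
  "no_double S \<longleftrightarrow> (\<forall>x. \<not> (orb x 0 \<in> S \<and> orb x 1 \<in> S))"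

text \<open>P_0 = prod_x (1 - n_{x,up} n_{x,down}) (diagonal in the occupation basis)\<close>
definition P0 :: "state \<Rightarrow> state" where
  "P0 \<psi> = (\<lambda>S. if no_double S then \<psi> S else 0)"

definition Vspace :: "nat \<Rightarrow> nat \<Rightarrow> state set" where
  "Vspace Ns Ne = {\<psi>. \<forall>S. \<psi> S \<noteq> 0 \<longrightarrow> S \<subseteq> {..<2*Ns} \<and> card S = Ne \<and> no_double S}"

definition Heff :: "nat \<Rightarrow> real \<Rightarrow> real \<Rightarrow> state \<Rightarrow> state" where
  "Heff Ns t t' \<psi> = P0 (Hprime Ns t t' (P0 \<psi>))"

definition is_eigenvalue :: "nat \<Rightarrow> nat \<Rightarrow> real \<Rightarrow> real \<Rightarrow> real \<Rightarrow> bool" where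
  "is_eigenvalue Ns Ne t t' E \<longleftrightarrow>
     (\<exists>\<psi>\<in>Vspace Ns Ne. \<psi> \<noteq> 0 \<and> Heff Ns t t' \<psi> = smul (complex_of_real E) \<psi>)"

definition eigenspace :: "nat \<Rightarrow> nat \<Rightarrow> real \<Rightarrow> real \<Rightarrow> real \<Rightarrow> state set" where
  "eigenspace Ns Ne t t' E = {\<psi>\<in>Vspace Ns Ne. Heff Ns t t' \<psi> = smul (complex_of_real E) \<psi>}"

definition pauli :: "nat \<Rightarrow> nat \<Rightarrow> nat \<Rightarrow> complex" where
  "pauli a s r =
    (if a = 1 then (if s \<noteq> r then 1 else 0)
     else if a = 2 then (if s = 0 \<and> r = 1 then - \<i> else if s = 1 \<and> r = 0 then \<i> else 0)
     else (if s = r then (if s = 0 then 1 else -1) else 0))"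

definition Stot :: "nat \<Rightarrow> nat \<Rightarrow> state \<Rightarrow> state" where
  "Stot Ns a \<psi> = smul (1/2)
     (\<Sum>x<Ns. \<Sum>s\<in>{0,1}. \<Sum>r\<in>{0,1}. smul (pauli a s r) (cre (orb x s) (ann (orb x r) \<psi>)))"

definition Stot_sq :: "nat \<Rightarrow> state \<Rightarrow> state" where
  "Stot_sq Ns \<psi> = (\<Sum>a\<in>{1,2,3}. Stot Ns a (Stot Ns a \<psi>))"

definition cdim :: "state set \<Rightarrow> nat" where
  "cdim W = vector_space.dim smul W"

end

theory Submission
  imports Defs "HOL-Analysis.Function_Topology" "HOL-Library.Multiset"
begin

text \<open>At \<open>U = \<infinity>\<close> with an odd number of electrons every fermionic sign disappears in the occupation
  basis: a hop across the boundary passes an even number of electrons, and the sign picked up when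
  hopping over an occupied site turns \<open>t'\<close> into \<open>- t'\<close>.  So the effective Hamiltonian is minus a
  nonnegative symmetric matrix whose entries do not see the spins.  On each sector with a fixed
  number of down spins this matrix is irreducible: hops around the ring rotate the sequence of
  spins and a hop over an occupied site transposes two neighbours.

  Let \<open>\<phi>\<close> be the Perron-Frobenius vector of the fully polarized sector.  Reading \<open>\<phi>\<close> on the occupied
  sites only gives a positive eigenvector with the same eigenvalue in every sector, hence the unique
  ground state of each of them.  The ground states are therefore the functions
  \<open>g(number of down spins) * \<phi>(occupied sites)\<close>, on which the total spin acts through \<open>g\<close> alone as
  the spin \<open>Ne/2\<close> representation.\<close>

section \<open>Perron-Frobenius theory of irreducible symmetric matrices\<close>

text \<open>Energies are compared by a maximum principle: a positive eigenvector with eigenvalue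
  \<open>l\<close> of an irreducible nonnegative symmetric matrix rules out eigenvalues above
  \<open>l\<close> and makes \<open>l\<close> simple. The same \<open>l\<close> serves every sector,
  so \<open>- l\<close> is the ground energy, with one state for each number 0, ...,
  \<open>Ne\<close> of down spins; this is the origin of the dimension \<open>Ne + 1\<close>. The
  obstacle is irreducibility. Nearest-neighbour hops preserve the cyclic order of the spins, so
  without \<open>t'\<close> two spin sequences that are not rotations of each other would stay
  disconnected. The bond from site 0 over site 1 to site 2 exchanges the first two spins once a hole
  sits at site 2, and rotations bring any two neighbours to the front. Irreducibility is used in the
  form \<open>conn\<close>, that a property preserved along positive entries is constant; it can
  then be checked by normalising configurations step by step.\<close>

locale irreducible_symmetric_matrix =
  fixes C :: "'a set" and A :: "'a \<Rightarrow> 'a \<Rightarrow> real"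
  assumes fin: "finite C"
    and nonneg: "\<And>X Y. X \<in> C \<Longrightarrow> Y \<in> C \<Longrightarrow> A X Y \<ge> 0"
    and sym: "\<And>X Y. X \<in> C \<Longrightarrow> Y \<in> C \<Longrightarrow> A X Y = A Y X"
    and conn: "\<And>P X Y. (\<And>X Y. X \<in> C \<Longrightarrow> Y \<in> C \<Longrightarrow> A X Y > 0 \<Longrightarrow> P X \<longleftrightarrow> P Y)
      \<Longrightarrow> X \<in> C \<Longrightarrow> Y \<in> C \<Longrightarrow> P X \<longleftrightarrow> P Y"
begin

text \<open>The quadratic form attains its maximum over the nonnegative unit vectors; since the entries are
  nonnegative, this is the maximum over all unit vectors, so the maximizer is an eigenvector.\<close>

lemma positive_eigenvector_exists:
  assumes ne: "C \<noteq> {}"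
  obtains \<phi> l where "\<And>X. X \<in> C \<Longrightarrow> \<phi> X > 0"
    and "\<And>X. X \<in> C \<Longrightarrow> (\<Sum>Y\<in>C. A X Y * \<phi> Y) = l * \<phi> X"
proof -
  \<comment> \<open>A box in the product topology, compact by Tychonoff. Coordinates outside
    \<open>C\<close> are pinned to 0, since a free one would destroy compactness.\<close>
  define B :: "('a \<Rightarrow> real) set" where "B = (\<Pi>\<^sub>E X\<in>UNIV. if X \<in> C then {0..1} else {0})"
  define K where "K = B \<inter> {\<phi>. (\<Sum>X\<in>C. (\<phi> X)\<^sup>2) = 1}"
  define Q where "Q = (\<lambda>\<phi>::'a \<Rightarrow> real. \<Sum>X\<in>C. \<Sum>Y\<in>C. A X Y * \<phi> X * \<phi> Y)"
  define N where "N = (\<lambda>\<phi>::'a \<Rightarrow> real. \<Sum>X\<in>C. (\<phi> X)\<^sup>2)"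
  have coord: "continuous_on S (\<lambda>\<phi>::'a \<Rightarrow> real. \<phi> X)" for S X
    by (rule continuous_on_subset[OF continuous_on_product_coordinates]) simp
  have "compactin (product_topology (\<lambda>i. euclidean) UNIV) B"
    unfolding B_def compactin_PiE by auto
  then have "compact B"
    by (simp add: euclidean_product_topology)
  moreover have "closed {\<phi>::'a \<Rightarrow> real. (\<Sum>X\<in>C. (\<phi> X)\<^sup>2) = 1}"
    by (intro closed_Collect_eq continuous_intros coord)
  ultimately have cK: "compact K"
    unfolding K_def by (rule compact_Int_closed)
  obtain X0 where X0: "X0 \<in> C" using ne by auto
  have "(\<Sum>X\<in>C. (if X = X0 then 1 else 0 :: real)\<^sup>2) = (\<Sum>X\<in>C. if X = X0 then 1 else 0)"
    by (rule sum.cong) auto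
  then have "(\<lambda>X. if X = X0 then 1 else 0) \<in> K"
    using X0 fin unfolding K_def B_def by auto
  then have Kne: "K \<noteq> {}" by auto
  have "continuous_on K Q"
    unfolding Q_def by (intro continuous_intros coord)
  from continuous_attains_sup[OF cK Kne this] obtain \<phi> where
    \<phi>: "\<phi> \<in> K" and mx: "\<And>\<psi>. \<psi> \<in> K \<Longrightarrow> Q \<psi> \<le> Q \<phi>" by auto
  have \<phi>0: "\<phi> X \<ge> 0" if "X \<in> C" for X
    using \<phi> that unfolding K_def B_def PiE_def Pi_def by (auto split: if_splits)
  have N\<phi>: "N \<phi> = 1" using \<phi> unfolding K_def N_def by auto
  have Qle: "Q \<psi> \<le> Q \<phi> * N \<psi>" for \<psi>
  proof (cases "N \<psi> = 0")
    case True
    then have "\<psi> X = 0" if "X \<in> C" for X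
      using fin that unfolding N_def by (subst (asm) sum_nonneg_eq_0_iff) auto
    then have "Q \<psi> = 0" unfolding Q_def by simp
    with True show ?thesis by simp
  next
    case False
    have "N \<psi> \<ge> 0" unfolding N_def by (simp add: sum_nonneg)
    with False have pos: "N \<psi> > 0" by simp
    define r where "r = sqrt (N \<psi>)"
    have r: "r > 0" "r\<^sup>2 = N \<psi>" using pos unfolding r_def by auto
    define \<chi> where "\<chi> = (\<lambda>X. if X \<in> C then \<bar>\<psi> X\<bar> / r else 0)"
    have s1: "(\<Sum>X\<in>C. (\<chi> X)\<^sup>2) = 1"
    proof -
      have "(\<Sum>X\<in>C. (\<chi> X)\<^sup>2) = (\<Sum>X\<in>C. (\<psi> X)\<^sup>2 / N \<psi>)"
        by (rule sum.cong) (auto simp: \<chi>_def power_divide r)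
      also have "\<dots> = 1" using pos by (simp add: sum_divide_distrib[symmetric] N_def)
      finally show ?thesis .
    qed
    have "\<chi> X \<in> {0..1}" if "X \<in> C" for X
    proof -
      have "(\<chi> X)\<^sup>2 \<le> 1"
        using member_le_sum[of X C "\<lambda>X. (\<chi> X)\<^sup>2"] that fin s1 by auto
      then have "\<chi> X \<le> 1" by (simp add: power2_le_iff_abs_le abs_square_le_1)
      moreover have "\<chi> X \<ge> 0" using r unfolding \<chi>_def by auto
      ultimately show ?thesis by auto
    qed
    then have "\<chi> \<in> K" using s1 unfolding K_def B_def by (auto simp: \<chi>_def)
    from mx[OF this] have "Q \<chi> \<le> Q \<phi>" .
    moreover have "Q \<psi> \<le> N \<psi> * Q \<chi>"
    proof -
      have "Q \<psi> \<le> (\<Sum>X\<in>C. \<Sum>Y\<in>C. A X Y * (\<bar>\<psi> X\<bar> * \<bar>\<psi> Y\<bar>))"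
        unfolding Q_def
      proof (intro sum_mono)
        fix X Y assume "X \<in> C" "Y \<in> C"
        have "\<psi> X * \<psi> Y \<le> \<bar>\<psi> X\<bar> * \<bar>\<psi> Y\<bar>" by (metis abs_ge_self abs_mult)
        then show "A X Y * \<psi> X * \<psi> Y \<le> A X Y * (\<bar>\<psi> X\<bar> * \<bar>\<psi> Y\<bar>)"
          using nonneg[OF \<open>X \<in> C\<close> \<open>Y \<in> C\<close>] by (metis mult.assoc mult_left_mono)
      qed
      also have "\<dots> = N \<psi> * Q \<chi>"
        unfolding Q_def sum_distrib_left
        by (intro sum.cong refl) (use r in \<open>auto simp: \<chi>_def r(2)[symmetric] power2_eq_square\<close>)
      finally show ?thesis .
    qed
    ultimately show ?thesis using pos
      by (smt (verit, ccfv_threshold) mult.commute mult_left_mono)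
  qed
  define l where "l = Q \<phi>"
  have eig: "(\<Sum>Y\<in>C. A X Y * \<phi> Y) = l * \<phi> X" if X: "X \<in> C" for X
  proof -
    define d where "d = (\<Sum>Y\<in>C. A X Y * \<phi> Y) - l * \<phi> X"
    \<comment> \<open>Variation of the single coordinate \<open>X\<close> by \<open>e\<close>.
      Inserted into \<open>Qle\<close>, it leaves a quadratic in \<open>e\<close> that is never
      positive, so its linear coefficient \<open>2 * d\<close> must vanish.\<close>
    have key: "2 * e * d + e\<^sup>2 * (A X X - l) \<le> 0" for e :: real
    proof -
      define u where "u = (\<lambda>Y. if Y = X then e else 0)"
      have us: "(\<Sum>Y\<in>C. g Y * u Y) = g X * e" for g
      proof -
        have "(\<Sum>Y\<in>C. g Y * u Y) = (\<Sum>Y\<in>C. if Y = X then g Y * e else 0)"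
          unfolding u_def by (rule sum.cong) auto
        then show ?thesis using X fin by simp
      qed
      have "N (\<lambda>Y. \<phi> Y + u Y) = (\<Sum>Y\<in>C. (\<phi> Y)\<^sup>2 + (2 * \<phi> Y) * u Y + u Y * u Y)"
        unfolding N_def by (intro sum.cong refl) (simp add: power2_eq_square algebra_simps)
      also have "\<dots> = 1 + 2 * \<phi> X * e + e\<^sup>2"
        using N\<phi> unfolding sum.distrib us N_def by (simp add: u_def power2_eq_square)
      finally have n: "N (\<lambda>Y. \<phi> Y + u Y) = 1 + 2 * \<phi> X * e + e\<^sup>2" .
      have "Q (\<lambda>Y. \<phi> Y + u Y) = (\<Sum>Z\<in>C. \<Sum>Y\<in>C. A Z Y * \<phi> Z * \<phi> Y + (A Z Y * \<phi> Z) * u Y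
          + (A Z Y * \<phi> Y) * u Z + (A Z Y * u Z) * u Y)"
        unfolding Q_def by (intro sum.cong refl) (simp add: algebra_simps)
      also have "\<dots> = l + (\<Sum>Z\<in>C. A Z X * \<phi> Z) * e + (\<Sum>Y\<in>C. A X Y * \<phi> Y) * e + A X X * e * e"
      proof -
        have "(\<Sum>Z\<in>C. \<Sum>Y\<in>C. (A Z Y * \<phi> Y) * u Z) = (\<Sum>Y\<in>C. A X Y * \<phi> Y) * e"
          unfolding sum_distrib_right[symmetric] us ..
        moreover have "(\<Sum>Z\<in>C. A Z X * u Z * e) = A X X * e * e"
          unfolding sum_distrib_right[symmetric] us ..
        ultimately show ?thesis
          unfolding sum.distrib us l_def Q_def by (simp add: sum_distrib_right)
      qed
      also have "(\<Sum>Z\<in>C. A Z X * \<phi> Z) = (\<Sum>Y\<in>C. A X Y * \<phi> Y)"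
        using sym X by (intro sum.cong) auto
      finally have q: "Q (\<lambda>Y. \<phi> Y + u Y) = l + 2 * e * (\<Sum>Y\<in>C. A X Y * \<phi> Y) + A X X * e\<^sup>2"
        by (simp add: power2_eq_square algebra_simps)
      show ?thesis using Qle[of "\<lambda>Y. \<phi> Y + u Y"] unfolding n q d_def l_def[symmetric]
        by (simp add: algebra_simps)
    qed
    have "d = 0"
    proof (rule ccontr)
      assume "d \<noteq> 0"
      \<comment> \<open>With \<open>e = d / m\<close> the linear term wins, because
        \<open>2 * m + (A X X - l) > m > 0\<close>.\<close>
      define m where "m = \<bar>A X X - l\<bar> + 1"
      have m: "m > 0" "A X X - l > - m" unfolding m_def by auto
      have "2 * (d / m) * d + (d / m)\<^sup>2 * (A X X - l) = (d / m)\<^sup>2 * (2 * m + (A X X - l))"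
        using m by (simp add: field_simps power2_eq_square)
      also have "\<dots> > 0" using m \<open>d \<noteq> 0\<close> by (intro mult_pos_pos) auto
      finally show False using key[of "d / m"] by simp
    qed
    then show ?thesis unfolding d_def by simp
  qed
  \<comment> \<open>The row sum at a zero of \<open>\<phi>\<close> is 0 and has nonnegative terms,
    so zeros spread along positive entries.\<close>
  have nb: "\<phi> Y = 0" if XY: "X \<in> C" "Y \<in> C" "A X Y > 0" and "\<phi> X = 0" for X Y
  proof -
    have "(\<Sum>Y\<in>C. A X Y * \<phi> Y) = 0" using eig[OF XY(1)] \<open>\<phi> X = 0\<close> by simp
    then have "A X Y * \<phi> Y = 0"
      using sum_nonneg_eq_0_iff[OF fin, of "\<lambda>Y. A X Y * \<phi> Y"] nonneg \<phi>0 XY by auto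
    then show ?thesis using XY by simp
  qed
  have "\<phi> X > 0" if X: "X \<in> C" for X
  proof (rule ccontr)
    assume "\<not> \<phi> X > 0"
    then have "\<phi> X = 0" using \<phi>0[OF X] by simp
    have "\<phi> Y = 0" if "Y \<in> C" for Y
    proof -
      have "\<phi> X = 0 \<longleftrightarrow> \<phi> Y = 0"
      proof (rule conn[where P = "\<lambda>X. \<phi> X = 0", OF _ X that])
        fix X Y assume "X \<in> C" "Y \<in> C" "A X Y > 0"
        then show "\<phi> X = 0 \<longleftrightarrow> \<phi> Y = 0" using nb[of X Y] nb[of Y X] sym[of X Y] by auto
      qed
      then show ?thesis using \<open>\<phi> X = 0\<close> by simp
    qed
    then show False using N\<phi> unfolding N_def by simp
  qed
  then show thesis using eig that by blast
qed


text \<open>Take \<open>k\<close> as the maximum of the ratio \<open>\<psi> / \<phi>\<close>. Where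
  it is attained, the nonnegative sum of \<open>A X Y * \<phi> Y * (k - f Y)\<close> equals
  \<open>(l - m) * k * \<phi> X\<close>. For \<open>l < m\<close> this forces
  \<open>k \<le> 0\<close>; for \<open>l = m\<close> the sum vanishes, so the maximum spreads to all
  neighbours and by \<open>conn\<close> to all of \<open>C\<close>.\<close>

lemma eigenvector_maximum_principle:
  assumes pos: "\<And>X. X \<in> C \<Longrightarrow> \<phi> X > 0"
    and eig: "\<And>X. X \<in> C \<Longrightarrow> (\<Sum>Y\<in>C. A X Y * \<phi> Y) = l * \<phi> X"
    and eig': "\<And>X. X \<in> C \<Longrightarrow> (\<Sum>Y\<in>C. A X Y * \<psi> Y) = m * \<psi> X"
    and le: "l \<le> m"
  shows "\<exists>k. (\<forall>X\<in>C. \<psi> X \<le> k * \<phi> X) \<and> (l < m \<longrightarrow> k \<le> 0) \<and>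
    (l = m \<longrightarrow> (\<forall>X\<in>C. \<psi> X = k * \<phi> X))"
proof (cases "C = {}")
  case True
  then show ?thesis by auto
next
  case False
  define f where "f X = \<psi> X / \<phi> X" for X
  define k where "k = Max (f ` C)"
  have \<psi>: "\<psi> X = f X * \<phi> X" if "X \<in> C" for X using pos[OF that] by (simp add: f_def)
  have fk: "f X \<le> k" if "X \<in> C" for X using fin that by (simp add: k_def)
  have "k \<in> f ` C" unfolding k_def using fin False by (intro Max_in) auto
  then obtain X0 where X0: "X0 \<in> C" "f X0 = k" by auto
  have bal: "(\<Sum>Y\<in>C. A X Y * \<phi> Y * (k - f Y)) = (l - m) * k * \<phi> X" if "X \<in> C" "f X = k" for X
  proof -
    have "(\<Sum>Y\<in>C. A X Y * \<phi> Y * (k - f Y)) = k * (\<Sum>Y\<in>C. A X Y * \<phi> Y) - (\<Sum>Y\<in>C. A X Y * \<psi> Y)"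
      unfolding sum_distrib_left sum_subtractf[symmetric]
      by (intro sum.cong refl) (simp add: \<psi> algebra_simps)
    then show ?thesis using eig[OF that(1)] eig'[OF that(1)] \<psi>[OF that(1)] that(2)
      by (simp add: algebra_simps)
  qed
  have nn: "A X Y * \<phi> Y * (k - f Y) \<ge> 0" if "X \<in> C" "Y \<in> C" for X Y
    using nonneg[OF that] pos[OF that(2)] fk[OF that(2)] by simp
  have "(l - m) * k * \<phi> X0 \<ge> 0"
    unfolding bal[OF X0, symmetric] by (intro sum_nonneg nn X0)
  then have "(l - m) * k \<ge> 0" using pos[OF X0(1)] by (simp add: zero_le_mult_iff)
  then have k0: "k \<le> 0" if "l < m" using that by (simp add: zero_le_mult_iff)
  have "\<psi> X = k * \<phi> X" if "l = m" and X: "X \<in> C" for X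
  proof -
    have nb: "f Y = k" if XY: "X \<in> C" "Y \<in> C" "A X Y > 0" and "f X = k" for X Y
    proof -
      have "(\<Sum>Y\<in>C. A X Y * \<phi> Y * (k - f Y)) = 0" using bal[OF XY(1) \<open>f X = k\<close>] \<open>l = m\<close> by simp
      then have "A X Y * \<phi> Y * (k - f Y) = 0"
        using sum_nonneg_eq_0_iff[OF fin, of "\<lambda>Y. A X Y * \<phi> Y * (k - f Y)"] nn XY by auto
      then show ?thesis using XY pos[OF XY(2)] by auto
    qed
    have "f X0 = k \<longleftrightarrow> f X = k"
    proof (rule conn[where P = "\<lambda>X. f X = k", OF _ X0(1) X])
      fix X Y assume "X \<in> C" "Y \<in> C" "A X Y > 0"
      then show "f X = k \<longleftrightarrow> f Y = k" using nb[of X Y] nb[of Y X] sym[of X Y] by auto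
    qed
    then show ?thesis using X0 \<psi>[OF X] by simp
  qed
  moreover have "\<psi> X \<le> k * \<phi> X" if "X \<in> C" for X
    using \<psi>[OF that] fk[OF that] pos[OF that] by simp
  ultimately show ?thesis using k0 by blast
qed

text \<open>The maximum principle is applied to \<open>\<psi>\<close> and to
  \<open>- \<psi>\<close>. If \<open>l < m\<close>, both are bounded above by nonpositive multiples
  of \<open>\<phi>\<close>, hence \<open>\<psi>\<close> vanishes.\<close>

lemma eigenvector_uniqueness:
  assumes pos: "\<And>X. X \<in> C \<Longrightarrow> \<phi> X > 0"
    and eig: "\<And>X. X \<in> C \<Longrightarrow> (\<Sum>Y\<in>C. A X Y * \<phi> Y) = l * \<phi> X"
    and eig': "\<And>X. X \<in> C \<Longrightarrow> (\<Sum>Y\<in>C. A X Y * \<psi> Y) = m * \<psi> X"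
    and le: "l \<le> m"
  obtains k where "\<And>X. X \<in> C \<Longrightarrow> \<psi> X = k * \<phi> X" and "l < m \<Longrightarrow> k = 0"
proof -
  from eigenvector_maximum_principle[OF assms] obtain k
    where k: "\<forall>X\<in>C. \<psi> X \<le> k * \<phi> X" "l < m \<longrightarrow> k \<le> 0"
      "l = m \<longrightarrow> (\<forall>X\<in>C. \<psi> X = k * \<phi> X)" by auto
  have neg: "(\<Sum>Y\<in>C. A X Y * - \<psi> Y) = m * - \<psi> X" if "X \<in> C" for X
    using eig'[OF that] by (simp add: sum_negf)
  from eigenvector_maximum_principle[OF pos eig neg le] obtain k'
    where k': "\<forall>X\<in>C. - \<psi> X \<le> k' * \<phi> X" "l < m \<longrightarrow> k' \<le> 0" by auto
  show thesis
  proof (cases "l = m")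
    case True
    then show ?thesis using k(3) that[of k] by simp
  next
    case False
    then have lm: "l < m" using le by simp
    have "\<psi> X = 0" if X: "X \<in> C" for X
    proof -
      have "k * \<phi> X \<le> 0" "k' * \<phi> X \<le> 0"
        using k(2) k'(2) lm pos[OF X] by (simp_all add: mult_le_0_iff)
      then show ?thesis using k(1) k'(1) X by fastforce
    qed
    then show ?thesis using that[of 0] by simp
  qed
qed

end

section \<open>Configurations without double occupancy\<close>

definition sites :: "nat set \<Rightarrow> nat set" where
  "sites S = (\<lambda>k. k div 2) ` S"

definition Conf :: "nat \<Rightarrow> nat \<Rightarrow> nat set set" where
  "Conf Ns Ne = {S. S \<subseteq> {..<2*Ns} \<and> card S = Ne \<and> no_double S}"

definition move :: "nat \<Rightarrow> nat \<Rightarrow> nat \<Rightarrow> nat set \<Rightarrow> nat set" where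
  "move a s b S = insert (orb b s) (S - {orb a s})"

text \<open>Spin down is \<open>s = 1\<close>, so the down orbitals are the odd numbers
  \<open>2 * x + 1\<close>.\<close>

definition ndown :: "nat set \<Rightarrow> nat" where
  "ndown S = card {k \<in> S. odd k}"

lemma orb_div2 [simp]: "s \<in> {0,1} \<Longrightarrow> orb x s div 2 = x"
  by (auto simp: orb_def)

lemma odd_orb [simp]: "s \<in> {0,1} \<Longrightarrow> odd (orb x s) \<longleftrightarrow> s = 1"
  by (auto simp: orb_def)

lemma orb_eq_iff [simp]:
  "s \<in> {0,1} \<Longrightarrow> r \<in> {0,1} \<Longrightarrow> orb x s = orb y r \<longleftrightarrow> x = y \<and> s = r"
  by (metis odd_orb orb_div2 insertE singletonD)

lemma orb_cases: obtains x s where "k = orb x s" "s \<in> {0,1::nat}"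
proof
  show "k = orb (k div 2) (k mod 2)" by (simp add: orb_def)
  show "k mod 2 \<in> {0,1}" by auto
qed

lemma orb_less_iff: "s \<in> {0,1} \<Longrightarrow> orb x s < 2 * n \<longleftrightarrow> x < n"
  by (auto simp: orb_def)

lemma orb_in_sites: "s \<in> {0,1} \<Longrightarrow> orb x s \<in> S \<Longrightarrow> x \<in> sites S"
  unfolding sites_def by (metis image_eqI orb_div2)

lemma sites_iff: "x \<in> sites S \<longleftrightarrow> (\<exists>s\<in>{0,1}. orb x s \<in> S)"
proof
  assume "x \<in> sites S"
  then obtain k where k: "k \<in> S" "x = k div 2" unfolding sites_def by auto
  obtain y s where "k = orb y s" "s \<in> {0,1::nat}" by (rule orb_cases)
  with k show "\<exists>s\<in>{0,1}. orb x s \<in> S" by auto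
qed (auto intro: orb_in_sites[of 0] orb_in_sites[of 1])

lemma no_doubleD: "no_double S \<Longrightarrow> orb x s \<in> S \<Longrightarrow> orb x r \<in> S \<Longrightarrow> s \<in> {0,1} \<Longrightarrow> r \<in> {0,1} \<Longrightarrow> s = r"
  unfolding no_double_def by auto

lemma no_doubleI:
  assumes "\<And>x s r. orb x s \<in> S \<Longrightarrow> orb x r \<in> S \<Longrightarrow> s \<in> {0,1} \<Longrightarrow> r \<in> {0,1} \<Longrightarrow> s = r"
  shows "no_double S"
  unfolding no_double_def using assms[of _ 0 1] by auto

lemma no_double_inj: "no_double S \<Longrightarrow> inj_on (\<lambda>k. k div 2) S"
proof (rule inj_onI)
  fix k l assume *: "no_double S" "k \<in> S" "l \<in> S" "k div 2 = l div 2"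
  obtain x s where k: "k = orb x s" "s \<in> {0,1::nat}" by (rule orb_cases)
  obtain y r where l: "l = orb y r" "r \<in> {0,1::nat}" by (rule orb_cases)
  have "x = y" using * k l by auto
  then show "k = l" using no_doubleD[OF *(1)] * k l by auto
qed

lemma mem_move:
  "s \<in> {0,1} \<Longrightarrow> r \<in> {0,1} \<Longrightarrow> orb x r \<in> move a s b S \<longleftrightarrow>
    x = b \<and> r = s \<or> orb x r \<in> S \<and> \<not> (x = a \<and> r = s)"
  unfolding move_def by auto

lemma sites_move:
  assumes "no_double S" "s \<in> {0,1}" "orb a s \<in> S"
  shows "sites (move a s b S) = insert b (sites S - {a})"
proof -
  have "(\<lambda>k. k div 2) ` (S - {orb a s}) = sites S - {a}"
    using assms inj_on_image_set_diff[OF no_double_inj[OF assms(1)], of S "{orb a s}"]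
    unfolding sites_def by auto
  then show ?thesis using assms(2) unfolding move_def sites_def[of "insert _ _"] by simp
qed

lemma no_double_move:
  assumes "no_double S" "s \<in> {0,1}" "b \<notin> sites S"
  shows "no_double (move a s b S)"
proof (rule no_doubleI)
  fix x s1 r1
  assume "orb x s1 \<in> move a s b S" "orb x r1 \<in> move a s b S" "s1 \<in> {0,1}" "r1 \<in> {0,1}"
  then show "s1 = r1"
    using assms no_doubleD[OF assms(1), of x s1 r1] unfolding sites_iff by (auto simp: mem_move)
qed

lemma move_inverse:
  assumes "s \<in> {0,1}" "orb a s \<in> S" "b \<notin> sites S"
  shows "move b s a (move a s b S) = S"
  using assms orb_in_sites[of s b S] unfolding move_def by auto

lemma card_move:
  assumes "finite S" "s \<in> {0,1}" "orb a s \<in> S" "b \<notin> sites S"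
  shows "card (move a s b S) = card S"
proof -
  have "orb b s \<notin> S - {orb a s}" using assms orb_in_sites by blast
  then show ?thesis unfolding move_def using assms(1,3) by (metis card_Suc_Diff1 card_insert_disjoint finite_Diff)
qed

lemma ndown_move:
  assumes "finite S" "s \<in> {0,1}" "orb a s \<in> S" "b \<notin> sites S"
  shows "ndown (move a s b S) = ndown S"
proof -
  define D where "D = {k \<in> S. odd k}"
  have fD: "finite D" using assms unfolding D_def by auto
  have nb: "orb b s \<notin> S" using assms orb_in_sites by blast
  show ?thesis
  proof (cases "s = 1")
    case True
    then have "{k \<in> move a s b S. odd k} = insert (orb b s) (D - {orb a s})"
      unfolding D_def move_def using odd_orb[OF assms(2), of b] by (auto simp del: odd_orb)
    moreover have "orb a s \<in> D" "orb b s \<notin> D" using assms(3) nb True odd_orb[OF assms(2)] unfolding D_def by auto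
    ultimately show ?thesis unfolding ndown_def D_def[symmetric] using fD
      by (metis DiffD1 card_Suc_Diff1 card_insert_disjoint finite_Diff)
  next
    case False
    then have "{k \<in> move a s b S. odd k} = D"
      unfolding D_def move_def using odd_orb[OF assms(2)] by auto
    then show ?thesis unfolding ndown_def D_def by simp
  qed
qed

lemma Conf_no_double: "S \<in> Conf Ns Ne \<Longrightarrow> no_double S"
  unfolding Conf_def by auto

lemma Conf_finite: "S \<in> Conf Ns Ne \<Longrightarrow> finite S"
  unfolding Conf_def by (auto intro: finite_subset)

lemma finite_Conf: "finite (Conf Ns Ne)"
  by (rule finite_subset[of _ "Pow {..<2*Ns}"]) (auto simp: Conf_def)

lemma Conf_move:
  assumes "S \<in> Conf Ns Ne" "s \<in> {0,1}" "orb a s \<in> S" "b \<notin> sites S" "b < Ns"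
  shows "move a s b S \<in> Conf Ns Ne"
proof -
  have "move a s b S \<subseteq> {..<2*Ns}"
    using assms orb_less_iff[OF assms(2), of b Ns] unfolding Conf_def move_def by auto
  then show ?thesis
    using assms no_double_move card_move[OF Conf_finite[OF assms(1)] assms(2-4)] unfolding Conf_def by auto
qed

lemma Conf_sites:
  assumes "S \<in> Conf Ns Ne"
  shows "sites S \<subseteq> {..<Ns}" "card (sites S) = Ne" "finite (sites S)"
proof -
  show "sites S \<subseteq> {..<Ns}" using assms unfolding Conf_def sites_def by auto
  show "card (sites S) = Ne"
    using assms card_image[OF no_double_inj] unfolding Conf_def sites_def by auto
  show "finite (sites S)" using Conf_finite[OF assms] unfolding sites_def by simp
qed

lemma Vspace_iff: "\<psi> \<in> Vspace Ns Ne \<longleftrightarrow> (\<forall>S. S \<notin> Conf Ns Ne \<longrightarrow> \<psi> S = 0)"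
  unfolding Vspace_def Conf_def by auto

lemma sum_fun_apply: "(\<Sum>x\<in>I. (f x :: 'a \<Rightarrow> 'b::comm_monoid_add)) y = (\<Sum>x\<in>I. f x y)"
  by (induction I rule: infinite_finite_induct) auto

section \<open>Hopping terms and their fermionic signs in the occupation basis\<close>

lemma cre_ann_apply:
  "cre k (ann l \<psi>) S = (if k \<in> S \<and> l \<notin> S - {k}
     then fsign (S - {k}) k * fsign (S - {k}) l * \<psi> (insert l (S - {k})) else 0)"
  unfolding cre_def ann_def by auto

lemma fsign_mult_self: "fsign S k * fsign S k = 1"
  unfolding fsign_def by (simp add: power_mult_distrib[symmetric])

lemma numop_apply: "numop k \<psi> S = (if k \<in> S then \<psi> S else 0)"
  unfolding numop_def cre_ann_apply by (auto simp: fsign_mult_self insert_absorb)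

lemma nsite_apply:
  "nsite z \<psi> S = (of_bool (orb z 0 \<in> S) + of_bool (orb z 1 \<in> S)) * \<psi> S"
  unfolding nsite_def by (simp add: numop_apply)

lemma nsite_apply_no_double:
  assumes "no_double S"
  shows "nsite z \<psi> S = of_bool (z \<in> sites S) * \<psi> S"
  unfolding nsite_apply sites_iff using assms unfolding no_double_def by auto

text \<open>Orbitals below both \<open>k\<close> and \<open>l\<close> are counted twice and cancel;
  those in between remain.\<close>

lemma fsign_mult:
  assumes "finite T"
  shows "fsign T k * fsign T l = (-1) ^ card {j \<in> T. min k l \<le> j \<and> j < max k l}"
proof -
  have *: "fsign T k * fsign T l = (-1) ^ card {j \<in> T. k \<le> j \<and> j < l}" if "k \<le> l" for k l
  proof -
    have "{j \<in> T. j < l} = {j \<in> T. j < k} \<union> {j \<in> T. k \<le> j \<and> j < l}" using that by auto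
    moreover have "card ({j \<in> T. j < k} \<union> {j \<in> T. k \<le> j \<and> j < l})
        = card {j \<in> T. j < k} + card {j \<in> T. k \<le> j \<and> j < l}"
      by (rule card_Un_disjoint) (use assms in auto)
    ultimately have "card {j \<in> T. j < l} = card {j \<in> T. j < k} + card {j \<in> T. k \<le> j \<and> j < l}"
      by (rule ssubst)
    then have "fsign T l = fsign T k * (-1) ^ card {j \<in> T. k \<le> j \<and> j < l}"
      unfolding fsign_def power_add[symmetric] by (rule arg_cong)
    then show ?thesis
      by (simp add: mult.assoc[symmetric] fsign_mult_self)
  qed
  show ?thesis
  proof (cases "k \<le> l")
    case True
    then show ?thesis using *[OF True] by (simp add: min_def max_def)
  next
    case False
    then show ?thesis using *[of l k] by (simp add: min_def max_def mult.commute)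
  qed
qed

text \<open>Orbitals are ordered by site first, and without double occupancy each occupied site
  carries exactly one of them. So orbitals passed correspond to sites passed, and the sign does not
  see the spins.\<close>

lemma hop_sign:
  assumes "no_double S" "finite S" "s \<in> {0,1}" "orb a s \<in> S" "b \<notin> sites S"
  shows "fsign (S - {orb a s}) (orb a s) * fsign (S - {orb a s}) (orb b s)
    = (-1) ^ card {x \<in> sites S. min a b < x \<and> x < max a b}"
proof -
  let ?J = "{j \<in> S - {orb a s}. min (orb a s) (orb b s) \<le> j \<and> j < max (orb a s) (orb b s)}"
  have "(\<lambda>k. k div 2) ` ?J = {x \<in> sites S. min a b < x \<and> x < max a b}" (is "?l = ?r")
  proof (intro set_eqI iffI)
    fix x assume "x \<in> ?l"
    then obtain j where j: "j \<in> ?J" "x = j div 2" by auto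
    obtain y r where jr: "j = orb y r" "r \<in> {0,1::nat}" by (rule orb_cases)
    then have xy: "y = x" using j by simp
    have "x \<in> sites S" using j unfolding sites_def by auto
    moreover have "x \<noteq> a"
    proof
      assume "x = a"
      then have "j = orb a r" "orb a r \<in> S" using j(1) jr xy by (blast, blast)
      then show False using no_doubleD[OF assms(1,4) _ assms(3) jr(2)] j(1) by blast
    qed
    moreover have "x \<noteq> b" using assms(5) calculation by auto
    moreover have "min a b \<le> x" "x \<le> max a b"
      using div_le_mono[of "min (orb a s) (orb b s)" j 2] div_le_mono[of j "max (orb a s) (orb b s)" 2]
        j assms(3) by (auto simp: min_def max_def split: if_splits)
    ultimately show "x \<in> ?r" by (auto simp: min_def max_def split: if_splits)
  next
    fix x assume x: "x \<in> ?r"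
    then obtain r where r: "r \<in> {0,1}" "orb x r \<in> S" unfolding sites_iff by auto
    have ord: "orb y p < orb z q" if "y < z" "p \<in> {0,1}" for y z p q
      using that by (auto simp: orb_def)
    have "orb x r \<in> ?J" using x r assms(3) ord[of a x s r] ord[of b x s r] ord[of x a r s] ord[of x b r s]
      by (cases "a \<le> b") (auto simp: min_def max_def)
    then show "x \<in> ?l" using r orb_div2[OF r(1), of x] by (metis (no_types, lifting) image_eqI)
  qed
  moreover have "inj_on (\<lambda>k. k div 2) ?J"
    using no_double_inj[OF assms(1)] by (rule inj_on_subset) auto
  ultimately have "card ?J = card {x \<in> sites S. min a b < x \<and> x < max a b}"
    using card_image by fastforce
  then show ?thesis using fsign_mult[of "S - {orb a s}"] assms(2) by simp
qed

text \<open>The amplitude at \<open>S\<close> is fetched from the configuration before the hop, in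
  which the electron now at \<open>a\<close> still sits at \<open>b\<close>; this is why
  \<open>move a s b S\<close> appears on the right. If \<open>b\<close> is occupied in
  \<open>S\<close> by the opposite spin, that earlier configuration has a doubly occupied site,
  where \<open>\<chi>\<close> vanishes: this is the effect of the projection.\<close>

lemma hop_apply:
  assumes "no_double S" "finite S" "s \<in> {0,1}" "a \<noteq> b"
    and \<chi>: "\<And>T. \<not> no_double T \<Longrightarrow> \<chi> T = 0"
  shows "cre (orb a s) (ann (orb b s) \<chi>) S = (if orb a s \<in> S \<and> b \<notin> sites S
    then (-1) ^ card {x \<in> sites S. min a b < x \<and> x < max a b} * \<chi> (move a s b S) else 0)"
proof (cases "orb a s \<in> S")
  case True
  show ?thesis
  proof (cases "b \<in> sites S")
    case False
    then have "orb b s \<notin> S" using assms(3) orb_in_sites by blast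
    then show ?thesis using True False hop_sign[OF assms(1-3) True False]
      unfolding cre_ann_apply move_def by simp
  next
    case b: True
    then obtain r where r: "r \<in> {0,1}" "orb b r \<in> S" unfolding sites_iff by auto
    show ?thesis
    proof (cases "r = s")
      case True
      then have "orb b s \<in> S - {orb a s}" using r(2) assms(3,4) by simp
      then show ?thesis using b unfolding cre_ann_apply by simp
    next
      case False
      have "orb b r \<in> move a s b S" "orb b s \<in> move a s b S"
        using mem_move[OF assms(3) r(1), of b a b S] mem_move[OF assms(3) assms(3), of b a b S] r False by auto
      then have "\<not> no_double (move a s b S)"
        using False r(1) assms(3) no_doubleD[of "move a s b S" b r s] by blast
      then have "\<chi> (move a s b S) = 0" by (rule \<chi>)
      then show ?thesis using b unfolding cre_ann_apply move_def by simp
    qed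
  qed
next
  case False
  then show ?thesis by (simp add: cre_ann_apply)
qed

section \<open>The hopping matrix\<close>

text \<open>Converts a sum over bonds into a double sum over ordered pairs of sites. Bonds with the
  same end points are allowed and their weights add up, as happens on a ring of two sites.\<close>

lemma sum_pair_delta:
  fixes F :: "nat \<Rightarrow> nat \<Rightarrow> 'v::real_vector"
  assumes "\<And>x. x \<in> I \<Longrightarrow> p x < N" "\<And>x. x \<in> I \<Longrightarrow> q x < N"
  shows "(\<Sum>a<N. \<Sum>b<N. (\<Sum>x\<in>I. w x * of_bool (a = p x \<and> b = q x)) *\<^sub>R F a b)
    = (\<Sum>x\<in>I. w x *\<^sub>R F (p x) (q x))"
proof -
  have d: "(\<Sum>a<N. \<Sum>b<N. (w x * of_bool (a = p x \<and> b = q x)) *\<^sub>R F a b) = w x *\<^sub>R F (p x) (q x)"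
    if "x \<in> I" for x
  proof -
    have "(\<Sum>b<N. (w x * of_bool (a = p x \<and> b = q x)) *\<^sub>R F a b)
        = (if a = p x then w x *\<^sub>R F a (q x) else 0)" for a
    proof -
      have "(\<Sum>b<N. (w x * of_bool (a = p x \<and> b = q x)) *\<^sub>R F a b)
          = (\<Sum>b<N. if b = q x then (if a = p x then w x *\<^sub>R F a b else 0) else 0)"
        by (rule sum.cong) auto
      then show ?thesis using assms(2)[OF that] by simp
    qed
    then show ?thesis using assms(1)[OF that] by simp
  qed
  have "(\<Sum>a<N. \<Sum>b<N. (\<Sum>x\<in>I. w x * of_bool (a = p x \<and> b = q x)) *\<^sub>R F a b)
    = (\<Sum>x\<in>I. \<Sum>a<N. \<Sum>b<N. (w x * of_bool (a = p x \<and> b = q x)) *\<^sub>R F a b)"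
    unfolding scaleR_sum_left
    by (subst sum.swap) (rule sum.cong[OF refl], subst sum.swap, rule refl)
  also have "\<dots> = (\<Sum>x\<in>I. w x *\<^sub>R F (p x) (q x))"
    by (rule sum.cong) (simp_all add: d)
  finally show ?thesis .
qed

locale hubbard_ring =
  fixes Ns Ne :: nat and t t' :: real
  assumes even_Ns: "even Ns" and t_pos: "t > 0" and t'_pos: "t' > 0"
    and odd_Ne: "odd Ne" and Ne_less: "Ne < Ns"
begin

lemma Ns_ge_2: "Ns \<ge> 2"
  using odd_pos[OF odd_Ne] Ne_less by simp

text \<open>Amplitudes of minus the effective Hamiltonian with the fermionic signs already absorbed,
  so that \<open>t\<close> and \<open>t'\<close> both enter positively. \<open>X\<close> is the set
  of occupied sites; it decides which \<open>t'\<close> bonds are active.\<close>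

definition hop_amp :: "nat set \<Rightarrow> nat \<Rightarrow> nat \<Rightarrow> real" where
  "hop_amp X a b =
     (\<Sum>x\<in>{1..Ns}. t * of_bool (a = x mod Ns \<and> b = (x+1) mod Ns))
   + (\<Sum>x\<in>{1..Ns}. t * of_bool (a = (x+1) mod Ns \<and> b = x mod Ns))
   + (\<Sum>j\<in>{1..Ns div 2}. (t' * of_bool ((2*j+1) mod Ns \<in> X)) *
        of_bool (a = (2*j) mod Ns \<and> b = (2*j+2) mod Ns))
   + (\<Sum>j\<in>{1..Ns div 2}. (t' * of_bool ((2*j+1) mod Ns \<in> X)) *
        of_bool (a = (2*j+2) mod Ns \<and> b = (2*j) mod Ns))"

lemma sum_hop_amp:
  fixes F :: "nat \<Rightarrow> nat \<Rightarrow> 'v::real_vector"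
  shows "(\<Sum>a<Ns. \<Sum>b<Ns. hop_amp X a b *\<^sub>R F a b) =
     (\<Sum>x\<in>{1..Ns}. t *\<^sub>R F (x mod Ns) ((x+1) mod Ns))
   + (\<Sum>x\<in>{1..Ns}. t *\<^sub>R F ((x+1) mod Ns) (x mod Ns))
   + (\<Sum>j\<in>{1..Ns div 2}. (t' * of_bool ((2*j+1) mod Ns \<in> X)) *\<^sub>R F ((2*j) mod Ns) ((2*j+2) mod Ns))
   + (\<Sum>j\<in>{1..Ns div 2}. (t' * of_bool ((2*j+1) mod Ns \<in> X)) *\<^sub>R F ((2*j+2) mod Ns) ((2*j) mod Ns))"
proof -
  have m: "k mod Ns < Ns" for k using Ns_ge_2 by simp
  show ?thesis
    unfolding hop_amp_def scaleR_add_left sum.distrib by (subst (1 2 3 4) sum_pair_delta) (rule m refl)+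
qed

lemma hop_amp_nonneg: "hop_amp X a b \<ge> 0"
  unfolding hop_amp_def using t_pos t'_pos by (intro add_nonneg_nonneg sum_nonneg mult_nonneg_nonneg) auto

lemma hop_amp_sym: "hop_amp X a b = hop_amp X b a"
  unfolding hop_amp_def by (simp add: conj_commute)

lemma odd_mod_Ns: "odd (k mod Ns) \<longleftrightarrow> odd k"
  using even_Ns by (simp add: dvd_mod_iff)

text \<open>A \<open>t'\<close> bond joins even sites and is controlled by an odd one, also across
  the boundary since \<open>Ns\<close> is even. A hop along it therefore leaves its controlling site
  untouched; this is what makes the hopping matrix symmetric.\<close>

lemma hop_amp_move: "hop_amp (insert b (X - {a})) a b = hop_amp X a b"
proof (cases "even a \<and> even b")
  case True
  have "(2*j+1) mod Ns \<in> insert b (X - {a}) \<longleftrightarrow> (2*j+1) mod Ns \<in> X" for j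
  proof -
    have "odd ((2*j+1) mod Ns)" using odd_mod_Ns[of "2*j+1"] by simp
    then show ?thesis using True by blast
  qed
  then show ?thesis unfolding hop_amp_def by (simp only:)
next
  case False
  have "even ((2*j) mod Ns)" "even ((2*j+2) mod Ns)" for j
    using odd_mod_Ns[of "2*j"] odd_mod_Ns[of "2*j+2"] by simp_all
  then have "\<not> (a = (2*j) mod Ns \<and> b = (2*j+2) mod Ns)" "\<not> (a = (2*j+2) mod Ns \<and> b = (2*j) mod Ns)" for j
    using False by blast+
  then show ?thesis unfolding hop_amp_def by (simp only: of_bool_eq mult_zero_right)
qed

lemma neighbour_cases:
  assumes "x \<in> {1..Ns}"
  shows "x mod Ns + 1 = (x+1) mod Ns \<or> x mod Ns = Ns - 1 \<and> (x+1) mod Ns = 0"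
proof (cases "x = Ns")
  case True
  then show ?thesis using Ns_ge_2 by (simp add: mod_Suc)
next
  case False
  then show ?thesis using assms by (auto simp: mod_Suc)
qed

lemma next_neighbour_cases:
  assumes "j \<in> {1..Ns div 2}"
  shows "(2*j) mod Ns + 1 = (2*j+1) mod Ns \<and> (2*j) mod Ns + 2 = (2*j+2) mod Ns
    \<or> (2*j) mod Ns = Ns - 2 \<and> (2*j+1) mod Ns = Ns - 1 \<and> (2*j+2) mod Ns = 0"
proof -
  define r where "r = (2*j) mod Ns"
  have r: "r < Ns" "even r" using Ns_ge_2 odd_mod_Ns[of "2*j"] by (auto simp: r_def)
  have "r + 1 < Ns" using r even_Ns by (metis Suc_eq_plus1 Suc_lessI even_Suc)
  then have 1: "(2*j+1) mod Ns = r + 1"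
    unfolding r_def by (metis mod_add_left_eq mod_less)
  show ?thesis
  proof (cases "r + 2 < Ns")
    case True
    then have "(2*j+2) mod Ns = r + 2"
      unfolding r_def by (metis mod_add_left_eq mod_less)
    then show ?thesis using 1 by (simp add: r_def)
  next
    case False
    then have r2: "r + 2 = Ns" using \<open>r + 1 < Ns\<close> by simp
    have "(2*j+2) mod Ns = (r + 2) mod Ns"
      unfolding r_def by (metis mod_add_left_eq)
    then have "(2*j+2) mod Ns = 0" using r2 by simp
    then show ?thesis using 1 r2 by (simp add: r_def[symmetric]) linarith
  qed
qed

lemma neighbour_sign:
  assumes X: "X \<subseteq> {..<Ns}" "card X = Ne" and "a \<in> X" "b \<notin> X"
    and ab: "a + 1 = b \<or> b + 1 = a \<or> a = Ns - 1 \<and> b = 0 \<or> b = Ns - 1 \<and> a = 0"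
  shows "even (card {x \<in> X. min a b < x \<and> x < max a b})"
proof (cases "a + 1 = b \<or> b + 1 = a")
  case True
  then have "{x \<in> X. min a b < x \<and> x < max a b} = {}" by auto
  then show ?thesis by (simp only: card.empty) simp
next
  case False
  then have ab': "a = Ns - 1 \<and> b = 0 \<or> b = Ns - 1 \<and> a = 0" using ab by blast
  have "{x \<in> X. min a b < x \<and> x < max a b} = X - {a}"
  proof (intro set_eqI iffI)
    fix x assume x: "x \<in> X - {a}"
    then have "x < Ns" "x \<noteq> a" "x \<noteq> b" using X assms by auto
    then show "x \<in> {x \<in> X. min a b < x \<and> x < max a b}"
      using x ab' by (auto simp: min_def max_def)
  qed auto
  moreover have "card (X - {a}) = Ne - 1" using assms by simp
  ultimately show ?thesis using odd_Ne by simp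
qed

text \<open>In the bulk only the electron at \<open>z\<close> is passed. A hop between
  \<open>Ns - 2\<close> and 0 has \<open>z\<close> outside the interval and passes all electrons
  except those at \<open>a\<close> and \<open>z\<close>, which are \<open>Ne - 2\<close>, again an
  odd number.\<close>

lemma next_neighbour_sign:
  assumes X: "X \<subseteq> {..<Ns}" "card X = Ne" and "a \<in> X" "b \<notin> X" "z \<in> X"
    and ab: "a + 2 = b \<and> a + 1 = z \<or> b + 2 = a \<and> b + 1 = z
      \<or> a = Ns - 2 \<and> b = 0 \<and> z = Ns - 1 \<or> b = Ns - 2 \<and> a = 0 \<and> z = Ns - 1"
  shows "odd (card {x \<in> X. min a b < x \<and> x < max a b})"
proof (cases "a + 2 = b \<and> a + 1 = z \<or> b + 2 = a \<and> b + 1 = z")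
  case True
  then have "{x \<in> X. min a b < x \<and> x < max a b} = {z}" using assms by auto
  then show ?thesis by (metis card_1_singleton_iff odd_one One_nat_def)
next
  case False
  then have ab': "a = Ns - 2 \<and> b = 0 \<and> z = Ns - 1 \<or> b = Ns - 2 \<and> a = 0 \<and> z = Ns - 1"
    using ab by blast
  have az: "a \<noteq> z" using ab' Ns_ge_2 by auto
  have "{x \<in> X. min a b < x \<and> x < max a b} = X - {a, z}"
  proof (intro set_eqI iffI)
    fix x assume x: "x \<in> X - {a, z}"
    then have "x < Ns" "x \<noteq> a" "x \<noteq> b" "x \<noteq> z" using X assms by auto
    then show "x \<in> {x \<in> X. min a b < x \<and> x < max a b}"
      using x ab' by (auto simp: min_def max_def)
  next
    fix x assume x: "x \<in> {x \<in> X. min a b < x \<and> x < max a b}"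
    then have "x \<noteq> z" using ab' by auto
    then show "x \<in> X - {a, z}" using x by auto
  qed
  moreover have fX: "finite X" using X finite_subset by auto
  moreover have "card (X - {a, z}) = Ne - 2" using assms az fX by (simp add: card_Diff_subset)
  moreover have "Ne \<ge> 2" using card_mono[OF fX, of "{a, z}"] assms az by simp
  ultimately show ?thesis using odd_Ne by simp
qed

text \<open>Values in any real vector space: it is applied to complex states and to the real
  Perron-Frobenius vector.\<close>

definition hop_sum :: "(nat set \<Rightarrow> 'v) \<Rightarrow> nat set \<Rightarrow> nat \<Rightarrow> nat \<Rightarrow> 'v::real_vector" where
  "hop_sum \<psi> S a b = (\<Sum>s\<in>{0,1}. if orb a s \<in> S \<and> b \<notin> sites S then \<psi> (move a s b S) else 0)"

lemma neighbour_term: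
  assumes "\<psi> \<in> Vspace Ns Ne" "S \<in> Conf Ns Ne" "x \<in> {1..Ns}"
    and ab: "a = x mod Ns \<and> b = (x+1) mod Ns \<or> a = (x+1) mod Ns \<and> b = x mod Ns"
  shows "(\<Sum>s\<in>{0,1}. cre (orb a s) (ann (orb b s) \<psi>) S) = hop_sum \<psi> S a b"
  unfolding hop_sum_def
proof (rule sum.cong[OF refl])
  fix s :: nat assume s: "s \<in> {0,1}"
  have "a + 1 = b \<or> b + 1 = a \<or> a = Ns - 1 \<and> b = 0 \<or> b = Ns - 1 \<and> a = 0"
    if "a = p \<and> b = q \<or> a = q \<and> b = p" "p + 1 = q \<or> p = Ns - 1 \<and> q = 0" for p q
    using that by auto
  note ab' = this[OF ab neighbour_cases[OF assms(3)]]
  have S: "no_double S" "finite S" using Conf_no_double[OF assms(2)] Conf_finite[OF assms(2)] .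
  have ne: "a \<noteq> b" using ab' Ns_ge_2 by auto
  have \<chi>: "\<And>T. \<not> no_double T \<Longrightarrow> \<psi> T = 0" using assms(1) unfolding Vspace_def by blast
  show "cre (orb a s) (ann (orb b s) \<psi>) S =
      (if orb a s \<in> S \<and> b \<notin> sites S then \<psi> (move a s b S) else 0)"
    using hop_apply[OF S s ne, of \<psi>, OF \<chi>]
      neighbour_sign[OF Conf_sites(1,2)[OF assms(2)] orb_in_sites[OF s] _ ab']
    by (simp add: minus_one_power_iff)
qed

lemma next_neighbour_term:
  assumes "\<psi> \<in> Vspace Ns Ne" "S \<in> Conf Ns Ne" "j \<in> {1..Ns div 2}"
    and ab: "a = (2*j) mod Ns \<and> b = (2*j+2) mod Ns \<or> a = (2*j+2) mod Ns \<and> b = (2*j) mod Ns"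
    and z: "z = (2*j+1) mod Ns"
  shows "(\<Sum>s\<in>{0,1}. cre (orb a s) (ann (orb b s) (nsite z \<psi>)) S)
    = - (of_bool (z \<in> sites S) *\<^sub>R hop_sum \<psi> S a b)"
  unfolding hop_sum_def scaleR_sum_right sum_negf[symmetric]
proof (rule sum.cong[OF refl])
  fix s :: nat assume s: "s \<in> {0,1}"
  have "a + 2 = b \<and> a + 1 = z \<or> b + 2 = a \<and> b + 1 = z
      \<or> a = Ns - 2 \<and> b = 0 \<and> z = Ns - 1 \<or> b = Ns - 2 \<and> a = 0 \<and> z = Ns - 1"
    if "a = p \<and> b = q \<or> a = q \<and> b = p" "z = r"
      "p + 1 = r \<and> p + 2 = q \<or> p = Ns - 2 \<and> r = Ns - 1 \<and> q = 0" for p q r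
    using that by auto
  note ab' = this[OF ab z next_neighbour_cases[OF assms(3)]]
  have S: "no_double S" "finite S" using Conf_no_double[OF assms(2)] Conf_finite[OF assms(2)] .
  show "cre (orb a s) (ann (orb b s) (nsite z \<psi>)) S =
      - (of_bool (z \<in> sites S) *\<^sub>R (if orb a s \<in> S \<and> b \<notin> sites S then \<psi> (move a s b S) else 0))"
  proof (cases "a = b")
    case True
    \<comment> \<open>This happens only for two sites, where a single electron never sees an occupied middle site.\<close>
    then have "Ns = 2" using ab' Ns_ge_2 by auto
    then have "Ne = 1" using Ne_less odd_Ne by (metis One_nat_def less_2_cases even_zero)
    have az: "a \<noteq> z" using ab' Ns_ge_2 by auto
    have z': "z \<notin> sites S" if "orb a s \<in> S"
    proof
      assume "z \<in> sites S"
      then have "{a, z} \<subseteq> sites S" using orb_in_sites[OF s that] by simp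
      then show False
        using card_mono[OF Conf_sites(3)[OF assms(2)], of "{a, z}"] az \<open>Ne = 1\<close>
          Conf_sites(2)[OF assms(2)] by simp
    qed
    have "orb a s \<in> S \<Longrightarrow> nsite z \<psi> S = 0"
      using nsite_apply_no_double[OF S(1), of z \<psi>] z' by simp
    then show ?thesis using True orb_in_sites[OF s, of a S]
      unfolding cre_ann_apply by (auto simp: insert_absorb)
  next
    case False
    have \<chi>: "\<And>T. \<not> no_double T \<Longrightarrow> nsite z \<psi> T = 0"
      using assms(1) unfolding Vspace_def nsite_apply by auto
    have zz: "z \<noteq> a" "z \<noteq> b" using ab' Ns_ge_2 by auto
    \<comment> \<open>\<open>nsite z\<close> acts on the configuration before the hop. Its
      occupation of \<open>z\<close> is that of \<open>S\<close>, because \<open>z\<close> is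
      neither end of the hop.\<close>
    have "nsite z \<psi> (move a s b S) = of_bool (z \<in> sites S) * \<psi> (move a s b S)"
      if "orb a s \<in> S" "b \<notin> sites S"
      using nsite_apply_no_double[OF no_double_move[OF S(1) s that(2)]] sites_move[OF S(1) s that(1)] zz
      by simp
    moreover have "odd (card {x \<in> sites S. min a b < x \<and> x < max a b})"
      if "orb a s \<in> S" "b \<notin> sites S" "z \<in> sites S"
      using next_neighbour_sign[OF Conf_sites(1,2)[OF assms(2)] orb_in_sites[OF s that(1)] that(2,3) ab'] .
    ultimately show ?thesis
      using hop_apply[OF S s False, of "nsite z \<psi>", OF \<chi>]
      by (cases "z \<in> sites S") (auto simp: minus_one_power_iff)
  qed
qed

lemma Hprime_apply:
  assumes "\<psi> \<in> Vspace Ns Ne" "S \<in> Conf Ns Ne"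
  shows "Hprime Ns t t' \<psi> S = - (\<Sum>a<Ns. \<Sum>b<Ns. hop_amp (sites S) a b *\<^sub>R hop_sum \<psi> S a b)"
proof -
  have 1: "(\<Sum>x\<in>{1..Ns}. \<Sum>s\<in>{0,1}.
          cre (orb (x mod Ns) s) (ann (orb ((x+1) mod Ns) s) \<psi>) S
        + cre (orb ((x+1) mod Ns) s) (ann (orb (x mod Ns) s) \<psi>) S)
     = (\<Sum>x\<in>{1..Ns}. hop_sum \<psi> S (x mod Ns) ((x+1) mod Ns)) + (\<Sum>x\<in>{1..Ns}. hop_sum \<psi> S ((x+1) mod Ns) (x mod Ns))"
    unfolding sum.distrib
    by (intro arg_cong2[where f = "(+)"] sum.cong refl) (rule neighbour_term[OF assms], assumption, blast)+
  have 2: "(\<Sum>j\<in>{1..Ns div 2}. \<Sum>s\<in>{0,1}.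
          cre (orb ((2*j) mod Ns) s) (ann (orb ((2*j+2) mod Ns) s) (nsite ((2*j+1) mod Ns) \<psi>)) S
        + cre (orb ((2*j+2) mod Ns) s) (ann (orb ((2*j) mod Ns) s) (nsite ((2*j+1) mod Ns) \<psi>)) S)
     = (\<Sum>j\<in>{1..Ns div 2}. - (of_bool ((2*j+1) mod Ns \<in> sites S) *\<^sub>R hop_sum \<psi> S ((2*j) mod Ns) ((2*j+2) mod Ns)))
     + (\<Sum>j\<in>{1..Ns div 2}. - (of_bool ((2*j+1) mod Ns \<in> sites S) *\<^sub>R hop_sum \<psi> S ((2*j+2) mod Ns) ((2*j) mod Ns)))"
    unfolding sum.distrib
    by (intro arg_cong2[where f = "(+)"] sum.cong refl) (rule next_neighbour_term[OF assms], assumption, blast, rule refl)+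
  show ?thesis
    unfolding Hprime_def smul_def plus_fun_apply sum_fun_apply 1 2 sum_hop_amp
    by (simp add: scaleR_conv_of_real sum_negf sum_distrib_left algebra_simps)
qed

lemma P0_Vspace: "\<psi> \<in> Vspace Ns Ne \<Longrightarrow> P0 \<psi> = \<psi>"
  unfolding P0_def Vspace_def by (rule ext) auto

lemma Heff_apply:
  assumes "\<psi> \<in> Vspace Ns Ne" "S \<in> Conf Ns Ne"
  shows "Heff Ns t t' \<psi> S = - (\<Sum>a<Ns. \<Sum>b<Ns. hop_amp (sites S) a b *\<^sub>R hop_sum \<psi> S a b)"
proof -
  have "Heff Ns t t' \<psi> S = Hprime Ns t t' \<psi> S"
    using assms(2) unfolding Heff_def P0_Vspace[OF assms(1)] by (simp add: P0_def Conf_def)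
  then show ?thesis using Hprime_apply[OF assms] by simp
qed

text \<open>Hops keep the number of electrons and stay on the ring: had the configuration before the
  hop been in \<open>Conf\<close>, then \<open>S\<close> would be as well. So the effective
  Hamiltonian does not lead out of \<open>Vspace\<close>.\<close>

lemma cre_ann_outside:
  assumes \<chi>: "\<And>T. T \<notin> Conf Ns Ne \<Longrightarrow> \<chi> T = 0" and "S \<notin> Conf Ns Ne" "no_double S"
    and s: "s \<in> {0,1}" and "a < Ns"
  shows "cre (orb a s) (ann (orb b s) \<chi>) S = 0"
proof -
  have "\<chi> (insert (orb b s) (S - {orb a s})) = 0" if S: "orb a s \<in> S" "orb b s \<notin> S - {orb a s}"
  proof (rule \<chi>, rule notI)
    assume *: "insert (orb b s) (S - {orb a s}) \<in> Conf Ns Ne"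
    have "S \<subseteq> {..<2*Ns}"
      using * S orb_less_iff[OF s, of a Ns] \<open>a < Ns\<close> unfolding Conf_def by auto
    moreover have fS: "finite S" using calculation finite_subset by auto
    have "card (insert (orb b s) (S - {orb a s})) = card S"
      using S fS by (metis card_Suc_Diff1 card_insert_disjoint finite_Diff)
    then have "card S = Ne" using * unfolding Conf_def by auto
    ultimately show False using assms(2,3) unfolding Conf_def by auto
  qed
  then show ?thesis unfolding cre_ann_apply by simp
qed

lemma Heff_outside:
  assumes "\<psi> \<in> Vspace Ns Ne" "S \<notin> Conf Ns Ne"
  shows "Heff Ns t t' \<psi> S = 0"
proof (cases "no_double S")
  case False
  then show ?thesis unfolding Heff_def by (simp add: P0_def)
next
  case True
  have m: "k mod Ns < Ns" for k using Ns_ge_2 by simp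
  have 0: "cre (orb a s) (ann (orb b s) \<psi>) S = 0" if "s \<in> {0,1}" "a < Ns" for a b s
    by (rule cre_ann_outside[OF _ assms(2) True that]) (use assms(1) in \<open>simp add: Vspace_iff\<close>)
  have 1: "cre (orb a s) (ann (orb b s) (nsite z \<psi>)) S = 0" if "s \<in> {0,1}" "a < Ns" for a b s z
    by (rule cre_ann_outside[OF _ assms(2) True that]) (use assms(1) in \<open>simp add: Vspace_iff nsite_apply\<close>)
  show ?thesis
    unfolding Heff_def P0_Vspace[OF assms(1)]
    by (simp add: P0_def Hprime_def smul_def sum_fun_apply 0 1 m)
qed

section \<open>The matrix of minus the effective Hamiltonian between configurations\<close>

definition hop_matrix :: "nat set \<Rightarrow> nat set \<Rightarrow> real" where
  "hop_matrix S S' = (\<Sum>a<Ns. \<Sum>b<Ns. \<Sum>s\<in>{0,1}.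
     hop_amp (sites S) a b * of_bool (orb a s \<in> S \<and> b \<notin> sites S \<and> S' = move a s b S))"

lemma hop_matrix_nonneg: "hop_matrix S S' \<ge> 0"
  unfolding hop_matrix_def by (intro sum_nonneg mult_nonneg_nonneg hop_amp_nonneg) auto

text \<open>Each hop from \<open>a\<close> to \<open>b\<close> that turns \<open>S\<close> into
  \<open>S'\<close> is undone by the hop back, whose amplitude is the same by
  \<open>hop_amp_move\<close> and \<open>hop_amp_sym\<close>. Exchanging the summation variables
  \<open>a\<close> and \<open>b\<close> then gives the transpose.\<close>

lemma hop_matrix_sym:
  assumes "no_double S" "no_double S'"
  shows "hop_matrix S S' = hop_matrix S' S"
proof -
  have *: "orb b s \<in> S' \<and> a \<notin> sites S' \<and> S = move b s a S' \<and> hop_amp (sites S') b a = hop_amp (sites S) a b"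
    if "no_double S" "s \<in> {0,1}" "orb a s \<in> S \<and> b \<notin> sites S \<and> S' = move a s b S" for S S' a b s
  proof -
    have ab: "a \<noteq> b" using that orb_in_sites by blast
    have "sites S' = insert b (sites S - {a})" using that sites_move by blast
    then show ?thesis
      using that ab move_inverse[of s a S b] hop_amp_move[of b "sites S" a] hop_amp_sym[of _ b a] mem_move[of s s b a b S]
      by auto
  qed
  have "hop_matrix S S' = (\<Sum>a<Ns. \<Sum>b<Ns. \<Sum>s\<in>{0,1}.
     hop_amp (sites S') b a * of_bool (orb b s \<in> S' \<and> a \<notin> sites S' \<and> S = move b s a S'))"
    unfolding hop_matrix_def
  proof (intro sum.cong refl)
    fix a b s :: nat assume s: "s \<in> {0,1}"
    show "hop_amp (sites S) a b * of_bool (orb a s \<in> S \<and> b \<notin> sites S \<and> S' = move a s b S) =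
      hop_amp (sites S') b a * of_bool (orb b s \<in> S' \<and> a \<notin> sites S' \<and> S = move b s a S')"
      (is "_ * of_bool ?P = _ * of_bool ?Q")
    proof (cases ?P)
      case True
      then show ?thesis using *[OF assms(1) s True] by simp
    next
      case False
      then have "\<not> ?Q" using *[OF assms(2) s, of b a S] by blast
      then show ?thesis using False by (simp only: of_bool_eq mult_zero_right)
    qed
  qed
  also have "\<dots> = hop_matrix S' S" unfolding hop_matrix_def by (rule sum.swap)
  finally show ?thesis .
qed

lemma hop_matrix_sum:
  fixes h :: "nat set \<Rightarrow> 'v::real_vector"
  assumes "finite C"
    and C: "\<And>a b s. b < Ns \<Longrightarrow> s \<in> {0,1} \<Longrightarrow> orb a s \<in> S \<Longrightarrow> b \<notin> sites S \<Longrightarrow> move a s b S \<in> C"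
  shows "(\<Sum>S'\<in>C. hop_matrix S S' *\<^sub>R h S') = (\<Sum>a<Ns. \<Sum>b<Ns. hop_amp (sites S) a b *\<^sub>R hop_sum h S a b)"
proof -
  have "(\<Sum>S'\<in>C. hop_matrix S S' *\<^sub>R h S') = (\<Sum>a<Ns. \<Sum>b<Ns. \<Sum>s\<in>{0,1}. \<Sum>S'\<in>C.
     (hop_amp (sites S) a b * of_bool (orb a s \<in> S \<and> b \<notin> sites S \<and> S' = move a s b S)) *\<^sub>R h S')"
    unfolding hop_matrix_def scaleR_sum_left by (simp only: sum.swap[of _ _ C])
  also have "\<dots> = (\<Sum>a<Ns. \<Sum>b<Ns. hop_amp (sites S) a b *\<^sub>R hop_sum h S a b)"
    unfolding hop_sum_def scaleR_sum_right
  proof (intro sum.cong refl)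
    fix a b s :: nat assume b: "b \<in> {..<Ns}" and s: "s \<in> {0,1}"
    have "(\<Sum>S'\<in>C. (hop_amp (sites S) a b * of_bool (orb a s \<in> S \<and> b \<notin> sites S \<and> S' = move a s b S)) *\<^sub>R h S')
      = (\<Sum>S'\<in>C. if S' = move a s b S then (if orb a s \<in> S \<and> b \<notin> sites S then hop_amp (sites S) a b *\<^sub>R h S' else 0) else 0)"
      by (rule sum.cong) auto
    also have "\<dots> = hop_amp (sites S) a b *\<^sub>R (if orb a s \<in> S \<and> b \<notin> sites S then h (move a s b S) else 0)"
      using assms(1) C[of b s a] b s by simp
    finally show "(\<Sum>S'\<in>C. (hop_amp (sites S) a b * of_bool (orb a s \<in> S \<and> b \<notin> sites S \<and> S' = move a s b S)) *\<^sub>R h S')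
      = hop_amp (sites S) a b *\<^sub>R (if orb a s \<in> S \<and> b \<notin> sites S then h (move a s b S) else 0)" .
  qed
  finally show ?thesis .
qed

lemma hop_matrix_pos:
  assumes "i < Ns" "j < Ns" "r \<in> {0,1}" "orb i r \<in> S" "j \<notin> sites S" "hop_amp (sites S) i j > 0"
  shows "hop_matrix S (move i r j S) > 0"
proof -
  let ?w = "\<lambda>a b s. hop_amp (sites S) a b * of_bool (orb a s \<in> S \<and> b \<notin> sites S \<and> move i r j S = move a s b S)"
  have nn: "?w a b s \<ge> 0" for a b s using hop_amp_nonneg by simp
  have j: "0 < (\<Sum>s\<in>{0,1}. ?w i j s)"
    by (rule sum_pos2[OF _ assms(3)]) (use assms(4-6) nn in simp_all)
  have i: "0 < (\<Sum>b<Ns. \<Sum>s\<in>{0,1}. ?w i b s)"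
    by (rule sum_pos2[OF finite_lessThan, where i = j]) (use assms(2) in simp, rule j, intro sum_nonneg nn)
  show ?thesis
    unfolding hop_matrix_def
    by (rule sum_pos2[OF finite_lessThan, where i = i]) (use assms(1) in simp, rule i, intro sum_nonneg nn)
qed

end

section \<open>Connectivity of the sectors\<close>

text \<open>Rotating any two neighbours to the front, swapping and rotating back gives all adjacent
  transpositions, and these generate all permutations. The multiset \<open>M\<close> is fixed
  because invariance is only available for words with the given numbers of up and down
  spins.\<close>

lemma invariant_if_rotate_swap:
  assumes swap: "\<And>s r v. mset (s # r # v) = M \<Longrightarrow> f (s # r # v) = f (r # s # v)"
    and rot: "\<And>s v. mset (s # v) = M \<Longrightarrow> f (s # v) = f (v @ [s])"
    and "mset xs = M" "mset ys = M"
  shows "f xs = f ys"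
proof -
  have rots: "mset (u @ v) = M \<Longrightarrow> f (u @ v) = f (v @ u)" for u v
  proof (induction u arbitrary: v)
    case (Cons s u)
    have "f ((s # u) @ v) = f (u @ (v @ [s]))" using rot[of s "u @ v"] Cons.prems by simp
    also have "\<dots> = f ((v @ [s]) @ u)" using Cons.prems by (intro Cons.IH) (simp add: ac_simps)
    finally show ?case by simp
  qed simp
  have swaps: "f (u @ s # r # v) = f (u @ r # s # v)" if "mset (u @ s # r # v) = M" for u s r v
  proof -
    have "f (u @ s # r # v) = f (s # r # v @ u)" using rots[of u "s # r # v"] that by simp
    also have "\<dots> = f (r # s # v @ u)" using that by (intro swap) (simp add: ac_simps)
    also have "\<dots> = f (u @ r # s # v)" using rots[of u "r # s # v"] that by (simp add: add_mset_commute)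
    finally show ?thesis .
  qed
  have move: "mset (p @ u @ x # v) = M \<Longrightarrow> f (p @ u @ x # v) = f (p @ x # u @ v)" for p u x v
  proof (induction u arbitrary: v rule: rev_induct)
    case (snoc y u)
    have "f (p @ (u @ [y]) @ x # v) = f (p @ u @ x # y # v)"
      using swaps[of "p @ u" y x v] snoc.prems by simp
    also have "\<dots> = f (p @ x # u @ y # v)"
      using snoc.prems by (intro snoc.IH) (simp add: add_mset_commute)
    finally show ?case by simp
  qed simp
  \<comment> \<open>Matching letter by letter: the first letter of \<open>xs\<close> is pulled to
    the front of \<open>ys\<close> and joins the common prefix \<open>p\<close>, which keeps the
    whole word of content \<open>M\<close>.\<close>
  have "mset (p @ xs) = M \<Longrightarrow> mset xs = mset ys \<Longrightarrow> f (p @ xs) = f (p @ ys)" for p xs ys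
  proof (induction xs arbitrary: p ys)
    case (Cons x xs)
    have "x \<in> set ys" using Cons.prems(2) by (metis list.set_intros(1) set_mset_mset)
    then obtain u v where ys: "ys = u @ x # v" by (meson split_list)
    have uv: "mset xs = mset (u @ v)" using Cons.prems(2) ys by simp
    have "f (p @ x # xs) = f ((p @ [x]) @ u @ v)"
      using Cons.IH[of "p @ [x]" "u @ v"] Cons.prems(1) uv by simp
    also have "\<dots> = f (p @ ys)"
      using move[of p u x v] Cons.prems ys uv by (simp add: ac_simps)
    finally show ?case .
  qed simp
  from this[of "[]" xs ys] show ?thesis using assms(3,4) by simp
qed

text \<open>Entry \<open>i\<close> of a list describes site \<open>i\<close>: \<open>None\<close> for an empty site, \<open>Some s\<close> for an electron of spin
  \<open>s\<close>.  Rotations and transpositions of the spin sequence become list manipulations.\<close>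

definition config :: "nat option list \<Rightarrow> nat set" where
  "config L = {orb i s |i s. i < length L \<and> L ! i = Some s}"

definition somes :: "'a option list \<Rightarrow> 'a list" where
  "somes L = map the (filter (\<lambda>z. z \<noteq> None) L)"

lemma somes_simps [simp]:
  "somes [] = []" "somes (None # L) = somes L" "somes (Some x # L) = x # somes L"
  "somes (L @ L') = somes L @ somes L'" "somes (map Some xs) = xs" "somes (replicate k None) = []"
  unfolding somes_def by (simp_all add: comp_def filter_map)

lemma length_somes_le: "length (somes L) \<le> length L"
  unfolding somes_def by simp

lemma set_somes: "set (somes L) = {s. Some s \<in> set L}"
  unfolding somes_def by force

lemma mset_eq_if_binary:
  assumes "set xs \<subseteq> {0,1::nat}" "set ys \<subseteq> {0,1}" "length xs = length ys"
    "length (filter (\<lambda>s. s = 1) xs) = length (filter (\<lambda>s. s = 1) ys)"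
  shows "mset xs = mset ys"
proof -
  have m: "mset zs = replicate_mset (length (filter (\<lambda>s. s = 1) zs)) 1
      + replicate_mset (length zs - length (filter (\<lambda>s. s = 1) zs)) 0" if "set zs \<subseteq> {0,1::nat}" for zs
    using that
  proof (induction zs)
    case (Cons z zs)
    then show ?case
      using length_filter_le[of "\<lambda>s. s = 1" zs] by (auto simp: Suc_diff_le)
  qed simp
  show ?thesis using m[OF assms(1)] m[OF assms(2)] assms(3,4) by simp
qed

lemma filter_somes:
  "length (filter (\<lambda>s. s = x) (somes L)) = length (filter (\<lambda>z. z = Some x) L)"
proof (induction L)
  case (Cons z L)
  then show ?case by (cases z) auto
qed simp

lemma orb_in_config:
  assumes "set (somes L) \<subseteq> {0,1}" "s \<in> {0,1}"
  shows "orb i s \<in> config L \<longleftrightarrow> i < length L \<and> L ! i = Some s"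
proof
  assume "orb i s \<in> config L"
  then obtain j r where j: "orb i s = orb j r" "j < length L" "L ! j = Some r"
    unfolding config_def by blast
  have "Some r \<in> set L" using j(2,3) nth_mem by metis
  then have "r \<in> {0,1}" using assms(1) unfolding set_somes by blast
  then show "i < length L \<and> L ! i = Some s" using j orb_eq_iff[OF assms(2), of r i j] by simp
qed (auto simp: config_def)

lemma nth_cases:
  assumes "set (somes L) \<subseteq> {0,1}" "i < length L"
  shows "L ! i = None \<or> L ! i = Some 0 \<or> L ! i = Some (1::nat)"
proof (cases "L ! i")
  case (Some r)
  then have "Some r \<in> set L" using assms(2) nth_mem by metis
  then have "r \<in> {0,1}" using assms(1) unfolding set_somes by blast
  then show ?thesis using Some by auto
qed simp

lemma sites_config:
  assumes "set (somes L) \<subseteq> {0,1}"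
  shows "sites (config L) = {i. i < length L \<and> L ! i \<noteq> None}"
proof (intro set_eqI iffI)
  fix i assume "i \<in> sites (config L)"
  then show "i \<in> {i. i < length L \<and> L ! i \<noteq> None}"
    unfolding sites_iff using orb_in_config[OF assms] by auto
next
  fix i assume i: "i \<in> {i. i < length L \<and> L ! i \<noteq> None}"
  then have "L ! i = Some 0 \<or> L ! i = Some 1" using nth_cases[OF assms, of i] by auto
  then show "i \<in> sites (config L)"
    using i orb_in_config[OF assms, of 0 i] orb_in_config[OF assms, of 1 i] unfolding sites_iff by auto
qed

lemma no_double_config: "set (somes L) \<subseteq> {0,1} \<Longrightarrow> no_double (config L)"
  by (rule no_doubleI) (simp add: orb_in_config)

lemma config_subset:
  assumes "set (somes L) \<subseteq> {0,1}"
  shows "config L \<subseteq> {..<2 * length L}"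
proof
  fix k assume k: "k \<in> config L"
  obtain i s where "k = orb i s" "s \<in> {0,1::nat}" by (rule orb_cases)
  then show "k \<in> {..<2 * length L}" using k orb_in_config[OF assms] orb_less_iff by blast
qed

lemma card_config:
  assumes "set (somes L) \<subseteq> {0,1}"
  shows "card (config L) = length (somes L)"
proof -
  have "card (config L) = card (sites (config L))"
    unfolding sites_def using card_image[OF no_double_inj[OF no_double_config[OF assms]]] by simp
  also have "\<dots> = length (somes L)"
    unfolding sites_config[OF assms] somes_def by (simp add: length_filter_conv_card)
  finally show ?thesis .
qed

lemma ndown_config:
  assumes "set (somes L) \<subseteq> {0,1}"
  shows "ndown (config L) = length (filter (\<lambda>s. s = 1) (somes L))"
proof -
  have "{k \<in> config L. odd k} = (\<lambda>i. orb i 1) ` {i. i < length L \<and> L ! i = Some 1}"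
  proof (intro set_eqI iffI)
    fix k assume k: "k \<in> {k \<in> config L. odd k}"
    obtain i s where k_eq: "k = orb i s" "s \<in> {0,1::nat}" by (rule orb_cases)
    then have "s = 1" using k odd_orb by blast
    then show "k \<in> (\<lambda>i. orb i 1) ` {i. i < length L \<and> L ! i = Some 1}"
      using k k_eq orb_in_config[OF assms, of s i] by blast
  next
    fix k assume "k \<in> (\<lambda>i. orb i 1) ` {i. i < length L \<and> L ! i = Some 1}"
    then obtain i where "k = orb i 1" "i < length L" "L ! i = Some 1" by auto
    then show "k \<in> {k \<in> config L. odd k}" using orb_in_config[OF assms, of 1 i] odd_orb[of 1 i] by simp
  qed
  moreover have "inj (\<lambda>i. orb i 1)" by (rule injI) (simp add: orb_def)
  ultimately have "ndown (config L) = card {i. i < length L \<and> L ! i = Some 1}"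
    unfolding ndown_def by (simp add: card_image inj_on_subset)
  then show ?thesis unfolding filter_somes by (simp add: length_filter_conv_card)
qed

lemma Conf_cfgE:
  assumes "S \<in> Conf Ns Ne"
  obtains L where "S = config L" "length L = Ns" "set (somes L) \<subseteq> {0,1}"
proof
  let ?g = "\<lambda>i. if orb i 0 \<in> S then Some 0 else if orb i 1 \<in> S then Some (1::nat) else None"
  let ?L = "map ?g [0..<Ns]"
  show l: "length ?L = Ns" by simp
  show b: "set (somes ?L) \<subseteq> {0,1}" unfolding set_somes by (auto split: if_splits)
  show "S = config ?L"
  proof (intro set_eqI)
    fix k
    obtain i s where k_eq: "k = orb i s" "s \<in> {0,1::nat}" by (rule orb_cases)
    have "orb i s \<in> S \<Longrightarrow> i < Ns" using assms orb_less_iff[OF k_eq(2)] unfolding Conf_def by blast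
    then show "k \<in> S \<longleftrightarrow> k \<in> config ?L"
      unfolding k_eq(1) orb_in_config[OF b k_eq(2)] using k_eq(2) no_doubleD[OF Conf_no_double[OF assms], of i 0 1]
      by (auto split: if_splits)
  qed
qed

lemma move_config:
  assumes b: "set (somes L) \<subseteq> {0,1}" and "i < length L" "j < length L" "i \<noteq> j"
    and "L ! i = Some s" "L ! j = None"
  shows "move i s j (config L) = config (L[i := None, j := Some s])"
proof (intro set_eqI)
  have s: "s \<in> {0,1}" using nth_cases[OF b assms(2)] assms(5) by auto
  have b': "set (somes (L[i := None, j := Some s])) \<subseteq> {0,1}"
    using b s unfolding set_somes by (auto dest!: set_update_subset_insert[THEN subsetD])
  fix k
  obtain l r where lr: "k = orb l r" "r \<in> {0,1::nat}" by (rule orb_cases)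
  show "k \<in> move i s j (config L) \<longleftrightarrow> k \<in> config (L[i := None, j := Some s])"
    unfolding lr(1) mem_move[OF s lr(2)] orb_in_config[OF b lr(2)] orb_in_config[OF b' lr(2)]
    using assms(2-6) by (auto simp: nth_list_update)
qed

section \<open>Hops as list manipulations, and irreducibility on each sector\<close>

context hubbard_ring
begin

lemma hop_amp_neighbour_pos:
  assumes "x \<in> {1..Ns}"
  shows "hop_amp X (x mod Ns) ((x+1) mod Ns) > 0" "hop_amp X ((x+1) mod Ns) (x mod Ns) > 0"
proof -
  show "hop_amp X (x mod Ns) ((x+1) mod Ns) > 0"
    unfolding hop_amp_def
  proof (intro add_pos_nonneg)
    show "0 < (\<Sum>y\<in>{1..Ns}. t * of_bool (x mod Ns = y mod Ns \<and> (x+1) mod Ns = (y+1) mod Ns))"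
      by (rule sum_pos2[OF _ assms]) (use t_pos in simp_all)
  qed (use t_pos t'_pos in \<open>auto intro!: sum_nonneg\<close>)
  then show "hop_amp X ((x+1) mod Ns) (x mod Ns) > 0" by (subst hop_amp_sym)
qed

lemma hop_amp_next_neighbour_pos:
  assumes "j \<in> {1..Ns div 2}" "(2*j+1) mod Ns \<in> X"
  shows "hop_amp X ((2*j) mod Ns) ((2*j+2) mod Ns) > 0"
  unfolding hop_amp_def
proof (rule add_pos_nonneg, rule add_nonneg_pos)
  show "0 < (\<Sum>i\<in>{1..Ns div 2}. (t' * of_bool ((2*i+1) mod Ns \<in> X)) *
        of_bool ((2*j) mod Ns = (2*i) mod Ns \<and> (2*j+2) mod Ns = (2*i+2) mod Ns))"
    by (rule sum_pos2[OF _ assms(1)]) (use assms(2) t'_pos in simp_all)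
qed (use t_pos t'_pos in \<open>auto intro!: sum_nonneg add_nonneg_nonneg\<close>)

text \<open>The bonds are indexed by 1, ..., \<open>Ns\<close>, so site 0 enters as
  \<open>x = Ns\<close>.\<close>

lemma hop_amp_right_pos: "i + 1 < Ns \<Longrightarrow> hop_amp X i (i + 1) > 0"
  using hop_amp_neighbour_pos(1)[of "if i = 0 then Ns else i" X] Ns_ge_2
  by (cases "i = 0") (auto simp: mod_Suc)

lemma hop_amp_wrap_pos: "hop_amp X 0 (Ns - 1) > 0"
  using hop_amp_neighbour_pos(2)[of "Ns - 1" X] Ns_ge_2 by simp

text \<open>The bond \<open>j = Ns div 2\<close>: its left end \<open>2 * j = Ns\<close> is site 0.
  For \<open>Ns = 2\<close> its right end would be site 0 too.\<close>

lemma hop_amp_over_pos: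
  assumes "Ns > 2" "1 \<in> X"
  shows "hop_amp X 0 2 > 0"
proof -
  have "2 * (Ns div 2) = Ns" using even_Ns by simp
  moreover have "(Ns + 1) mod Ns = 1" "(Ns + 2) mod Ns = 2"
    using mod_add_self1[of Ns 1] mod_add_self1[of Ns 2] assms(1) by simp_all
  ultimately have "(2 * (Ns div 2)) mod Ns = 0" "(2 * (Ns div 2) + 1) mod Ns = 1" "(2 * (Ns div 2) + 2) mod Ns = 2"
    by simp_all
  then show ?thesis using hop_amp_next_neighbour_pos[of "Ns div 2" X] assms by simp
qed

definition valid :: "nat option list \<Rightarrow> bool" where
  "valid L \<longleftrightarrow> length L = Ns \<and> length (somes L) = Ne \<and> set (somes L) \<subseteq> {0,1}"

lemma config_Conf: "valid L \<Longrightarrow> config L \<in> Conf Ns Ne"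
  using config_subset[of L] card_config[of L] no_double_config[of L] unfolding Conf_def valid_def by auto

context
  fixes P :: "nat set \<Rightarrow> 'b"
  assumes inv: "\<And>S S'. S \<in> Conf Ns Ne \<Longrightarrow> S' \<in> Conf Ns Ne \<Longrightarrow> hop_matrix S S' > 0 \<Longrightarrow> P S = P S'"
begin

lemma hop_invariant:
  assumes "valid L" "i < Ns" "j < Ns" "i \<noteq> j" "L ! i = Some s" "L ! j = None"
    "hop_amp (sites (config L)) i j > 0"
  shows "P (config L) = P (config (L[i := None, j := Some s]))"
proof -
  have L: "set (somes L) \<subseteq> {0,1}" "length L = Ns" using assms(1) unfolding valid_def by auto
  have s: "s \<in> {0,1}" using nth_cases[OF L(1), of i] assms(2,5) L(2) by auto
  have o: "orb i s \<in> config L" using orb_in_config[OF L(1) s] assms(2,5) L(2) by simp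
  have j: "j \<notin> sites (config L)" using sites_config[OF L(1)] assms(6) by simp
  have "P (config L) = P (move i s j (config L))"
    by (rule inv[OF config_Conf[OF assms(1)] Conf_move[OF config_Conf[OF assms(1)] s o j assms(3)]
          hop_matrix_pos[OF assms(2,3) s o j assms(7)]])
  then show ?thesis using move_config[OF L(1)] assms(2-6) L(2) by simp
qed

lemma step_right:
  assumes "valid (u @ Some s # None # v)"
  shows "P (config (u @ Some s # None # v)) = P (config (u @ None # Some s # v))"
proof -
  have l: "length u + 1 < Ns" using assms unfolding valid_def by auto
  show ?thesis
    using hop_invariant[OF assms, of "length u" "length u + 1" s] l hop_amp_right_pos[OF l]
    by (simp add: nth_append list_update_append)
qed

text \<open>The front electron leaves through the boundary and reappears at the end: the spin
  sequence is rotated by one.\<close>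

lemma step_wrap:
  assumes "valid (Some s # v @ [None])"
  shows "P (config (Some s # v @ [None])) = P (config (None # v @ [Some s]))"
proof -
  have l: "Ns = length v + 2" using assms unfolding valid_def by auto
  show ?thesis
    using hop_invariant[OF assms, of 0 "Ns - 1" s] l hop_amp_wrap_pos
    by (simp add: nth_append list_update_append)
qed

text \<open>The electron at site 0 jumps over the one at site 1 into the hole at site 2; with the
  hole ignored, the first two spins have changed places.\<close>

lemma step_over:
  assumes "valid (Some s # Some r # None # v)"
  shows "P (config (Some s # Some r # None # v)) = P (config (None # Some r # Some s # v))"
proof -
  have l: "Ns = length v + 3" using assms unfolding valid_def by auto
  have "1 \<in> sites (config (Some s # Some r # None # v))"
    using assms unfolding valid_def by (subst sites_config) auto
  then show ?thesis
    using hop_invariant[OF assms, of 0 2 s] l hop_amp_over_pos by (simp add: numeral_2_eq_2)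
qed

lemma push_None:
  "valid (u @ None # map Some w @ v) \<Longrightarrow>
    P (config (u @ None # map Some w @ v)) = P (config (u @ map Some w @ None # v))"
proof (induction w arbitrary: u)
  case (Cons x w)
  have "P (config (u @ None # map Some (x # w) @ v)) = P (config ((u @ [Some x]) @ None # map Some w @ v))"
    using step_right[of u x "map Some w @ v"] Cons.prems unfolding valid_def by simp
  also have "\<dots> = P (config ((u @ [Some x]) @ map Some w @ None # v))"
    using Cons.prems unfolding valid_def by (intro Cons.IH) (simp add: valid_def)
  finally show ?case by simp
qed simp

text \<open>Hops to the right by one site push all holes to the end without changing the order of
  the spins. Hence \<open>P\<close> depends only on the spin sequence
  \<open>somes L\<close>.\<close>

lemma pack:
  "valid (u @ L) \<Longrightarrow>
    P (config (u @ L)) = P (config (u @ map Some (somes L) @ replicate (length L - length (somes L)) None))"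
proof (induction L arbitrary: u)
  case (Cons z L)
  show ?case
  proof (cases z)
    case None
    let ?k = "length L - length (somes L)"
    have "P (config (u @ None # L)) = P (config ((u @ [None]) @ map Some (somes L) @ replicate ?k None))"
      using Cons.IH[of "u @ [None]"] Cons.prems None by simp
    also have "\<dots> = P (config (u @ map Some (somes L) @ None # replicate ?k None))"
      using push_None[of u "somes L" "replicate ?k None"] Cons.prems None length_somes_le[of L]
      unfolding valid_def by simp
    finally show ?thesis using None length_somes_le[of L] by (simp add: Suc_diff_le)
  next
    case (Some x)
    then show ?thesis using Cons.IH[of "u @ [Some x]"] Cons.prems by simp
  qed
qed simp

text \<open>By \<open>pack\<close> the value of \<open>P\<close> is a function \<open>q\<close> of
  the spin sequence, and \<open>step_wrap\<close> and \<open>step_over\<close> make \<open>q\<close>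
  invariant under rotations and front swaps. On a fixed sector the length and the number of ones
  determine the multiset of spins.\<close>

lemma invariant_on_sector:
  assumes "S \<in> Conf Ns Ne" "S' \<in> Conf Ns Ne" "ndown S = ndown S'"
  shows "P S = P S'"
proof -
  define q where "q xs = P (config (map Some xs @ replicate (Ns - Ne) None))" for xs
  have pq: "P (config L) = q (somes L)" if "valid L" for L
    using pack[of "[]" L] that unfolding q_def valid_def by simp
  obtain L where L: "S = config L" "length L = Ns" "set (somes L) \<subseteq> {0,1}"
    using Conf_cfgE[OF assms(1)] .
  obtain L' where L': "S' = config L'" "length L' = Ns" "set (somes L') \<subseteq> {0,1}"
    using Conf_cfgE[OF assms(2)] .
  have v: "valid L" "valid L'"
    using L L' assms(1,2) card_config[OF L(3)] card_config[OF L'(3)] unfolding valid_def Conf_def by auto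
  have m: "mset (somes L) = mset (somes L')"
  proof (rule mset_eq_if_binary[OF L(3) L'(3)])
    show "length (somes L) = length (somes L')" using v unfolding valid_def by simp
    show "length (filter (\<lambda>s. s = 1) (somes L)) = length (filter (\<lambda>s. s = 1) (somes L'))"
      using ndown_config[OF L(3)] ndown_config[OF L'(3)] assms(3) L(1) L'(1) by (simp only:)
  qed
  have ms: "length xs = Ne \<and> set xs \<subseteq> {0,1}" if "mset xs = mset (somes L)" for xs
    using v(1) that unfolding valid_def by (metis mset_eq_length mset_eq_setD)
  \<comment> \<open>At least one hole exists. It is the one that travels in both manipulations
    below; the other \<open>k\<close> holes stay at the end of \<open>?w\<close>.\<close>
  obtain k where k: "Ns - Ne = Suc k" using Ne_less by (metis Suc_diff_Suc)
  have NsNe: "Ns = Ne + Suc k" using k Ne_less by simp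
  have "q (somes L) = q (somes L')"
  proof (rule invariant_if_rotate_swap[where M = "mset (somes L)"])
    fix s r v assume "mset (s # r # v) = mset (somes L)"
    then have srv: "length (s # r # v) = Ne" "set (s # r # v) \<subseteq> {0,1}" using ms by blast+
    let ?w = "map Some v @ replicate k None"
    \<comment> \<open>Since \<open>pq\<close> ignores where the holes are, one of them may be placed
      right behind the first two electrons.\<close>
    have "q (s # r # v) = P (config (Some s # Some r # None # ?w))"
      using pq[of "Some s # Some r # None # ?w"] srv NsNe unfolding valid_def by simp
    also have "\<dots> = P (config (None # Some r # Some s # ?w))"
      by (rule step_over) (use srv NsNe in \<open>unfold valid_def, simp\<close>)
    also have "\<dots> = q (r # s # v)"
      using pq[of "None # Some r # Some s # ?w"] srv NsNe unfolding valid_def by simp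
    finally show "q (s # r # v) = q (r # s # v)" .
  next
    fix s v assume "mset (s # v) = mset (somes L)"
    then have sv: "length (s # v) = Ne" "set (s # v) \<subseteq> {0,1}" using ms by blast+
    let ?w = "map Some v @ replicate k None"
    have "q (s # v) = P (config (Some s # ?w @ [None]))"
      using pq[of "Some s # ?w @ [None]"] sv NsNe unfolding valid_def by simp
    also have "\<dots> = P (config (None # ?w @ [Some s]))"
      by (rule step_wrap) (use sv NsNe in \<open>unfold valid_def, simp\<close>)
    also have "\<dots> = q (v @ [s])"
      using pq[of "None # ?w @ [Some s]"] sv NsNe unfolding valid_def by simp
    finally show "q (s # v) = q (v @ [s])" .
  qed (simp_all add: m)
  then show ?thesis using pq v L(1) L'(1) by simp
qed

end

end

section \<open>Ferromagnetic states\<close>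

text \<open>Represents the set of occupied sites by the configuration with all these spins up, so
  that a vector on the fully polarized sector can be evaluated at any configuration.\<close>

definition polarize :: "nat set \<Rightarrow> nat set" where
  "polarize S = (\<lambda>x. orb x 0) ` sites S"

lemma orb_in_polarize: "s \<in> {0,1} \<Longrightarrow> orb x s \<in> polarize S \<longleftrightarrow> s = 0 \<and> x \<in> sites S"
  unfolding polarize_def image_iff by auto

lemma sites_polarize: "sites (polarize S) = sites S"
  unfolding set_eq_iff by (auto simp: sites_iff[of _ "polarize S"] orb_in_polarize simp del: One_nat_def)

lemma no_double_polarize: "no_double (polarize S)"
  by (rule no_doubleI) (simp add: orb_in_polarize)

lemma set_eq_orbI:
  assumes "\<And>x s. s \<in> {0,1} \<Longrightarrow> orb x s \<in> S \<longleftrightarrow> orb x s \<in> T"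
  shows "S = T"
proof (rule set_eqI)
  fix k
  obtain x s where "k = orb x s" "s \<in> {0,1::nat}" by (rule orb_cases)
  then show "k \<in> S \<longleftrightarrow> k \<in> T" using assms by blast
qed

lemma polarize_move:
  assumes "no_double S" "s \<in> {0,1}" "orb a s \<in> S"
  shows "polarize (move a s b S) = move a 0 b (polarize S)"
proof (rule set_eq_orbI)
  fix x r :: nat assume r: "r \<in> {0,1}"
  show "orb x r \<in> polarize (move a s b S) \<longleftrightarrow> orb x r \<in> move a 0 b (polarize S)"
    unfolding orb_in_polarize[OF r] sites_move[OF assms] mem_move[OF insertI1 r] by blast
qed

lemma ndown_polarize: "ndown (polarize S) = 0"
proof -
  have "{k \<in> polarize S. odd k} = {}" unfolding polarize_def orb_def by auto
  then show ?thesis unfolding ndown_def by (simp only: card.empty)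
qed

lemma Conf_polarize:
  assumes "S \<in> Conf Ns Ne"
  shows "polarize S \<in> Conf Ns Ne"
proof -
  have "card (polarize S) = card (sites S)"
    unfolding polarize_def by (rule card_image, rule inj_onI) (simp add: orb_def)
  moreover have "polarize S \<subseteq> {..<2*Ns}"
    using Conf_sites(1)[OF assms] unfolding polarize_def orb_def by auto
  ultimately show ?thesis using Conf_sites(2)[OF assms] no_double_polarize unfolding Conf_def by auto
qed

section \<open>Spin flips and the total spin of ferromagnetic states\<close>

definition flip :: "nat \<Rightarrow> nat \<Rightarrow> nat \<Rightarrow> nat set \<Rightarrow> nat set" where
  "flip x s r S = insert (orb x r) (S - {orb x s})"

lemma mem_flip:
  "s \<in> {0,1} \<Longrightarrow> r \<in> {0,1} \<Longrightarrow> q \<in> {0,1} \<Longrightarrow> orb y q \<in> flip x s r S \<longleftrightarrow>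
    y = x \<and> q = r \<or> orb y q \<in> S \<and> \<not> (y = x \<and> q = s)"
  unfolding flip_def by (simp del: insert_iff add: insert_iff[of "orb _ _"])

lemma sites_flip:
  assumes "s \<in> {0,1}" "r \<in> {0,1}" "orb x s \<in> S" "no_double S"
  shows "sites (flip x s r S) = sites S"
proof -
  have "(\<lambda>k. k div 2) ` (S - {orb x s}) = sites S - {x}"
    using assms inj_on_image_set_diff[OF no_double_inj[OF assms(4)], of S "{orb x s}"]
    unfolding sites_def by auto
  then show ?thesis
    using assms(2) orb_in_sites[OF assms(1,3)] unfolding flip_def sites_def[of "insert _ _"]
    by (simp add: insert_absorb)
qed

lemma Conf_flip:
  assumes "s \<in> {0,1}" "r \<in> {0,1}" "s \<noteq> r" "orb x s \<in> S" "S \<in> Conf Ns Ne"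
  shows "orb x r \<notin> S" "flip x s r S \<in> Conf Ns Ne"
    "int (ndown (flip x s r S)) = int (ndown S) + int r - int s"
proof -
  have nd: "no_double S" and fS: "finite S" using Conf_no_double[OF assms(5)] Conf_finite[OF assms(5)] .
  show nr: "orb x r \<notin> S" using no_doubleD[OF nd assms(4) _ assms(1,2)] assms(3) by blast
  have "card (flip x s r S) = card S"
    unfolding flip_def using nr assms(4) fS
    by (metis DiffD1 card_Suc_Diff1 card_insert_disjoint finite_Diff)
  moreover have "x < Ns" using assms(4,5) orb_less_iff[OF assms(1)] unfolding Conf_def by blast
  then have "flip x s r S \<subseteq> {..<2*Ns}"
    using assms(5) orb_less_iff[OF assms(2), of x Ns] unfolding Conf_def flip_def by blast
  moreover have "no_double (flip x s r S)"
  proof (rule no_doubleI)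
    fix y p q
    assume "orb y p \<in> flip x s r S" "orb y q \<in> flip x s r S" and pq: "p \<in> {0,1}" "q \<in> {0,1}"
    then have *: "y = x \<and> p = r \<or> orb y p \<in> S \<and> \<not> (y = x \<and> p = s)"
      "y = x \<and> q = r \<or> orb y q \<in> S \<and> \<not> (y = x \<and> q = s)"
      using mem_flip[OF assms(1,2)] by blast+
    show "p = q"
    proof (cases "y = x")
      case True
      then show ?thesis using * no_doubleD[OF nd assms(4) _ assms(1)] pq by blast
    next
      case False
      then show ?thesis using * no_doubleD[OF nd _ _ pq] by blast
    qed
  qed
  ultimately show "flip x s r S \<in> Conf Ns Ne" using assms(5) unfolding Conf_def by simp
  show "int (ndown (flip x s r S)) = int (ndown S) + int r - int s"
  proof (cases "s = 0")
    case True
    then have r: "r = 1" using assms(2,3) by simp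
    have "{k \<in> flip x s r S. odd k} = insert (orb x 1) {k \<in> S. odd k}"
      unfolding flip_def True r by (auto simp: orb_def)
    moreover have "orb x 1 \<notin> {k \<in> S. odd k}" using nr r by simp
    ultimately have "ndown (flip x s r S) = ndown S + 1"
      unfolding ndown_def using fS by (simp del: One_nat_def)
    then show ?thesis using True r by simp
  next
    case False
    then have s: "s = 1" and r: "r = 0" using assms(1-3) by auto
    have "{k \<in> flip x s r S. odd k} = {k \<in> S. odd k} - {orb x 1}"
      unfolding flip_def s r by (auto simp: orb_def)
    moreover have o: "orb x 1 \<in> {k \<in> S. odd k}" using assms(4) s by (simp add: orb_def)
    ultimately have "ndown S = ndown (flip x s r S) + 1"
      unfolding ndown_def using fS card_Suc_Diff1[OF _ o] by simp
    then show ?thesis using s r by simp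
  qed
qed

lemma flip_inverse:
  assumes "orb x s \<in> S" "orb x r \<notin> S"
  shows "flip x r s (flip x s r S) = S"
  using assms unfolding flip_def by auto

text \<open>The two orbitals of a site are consecutive, so no other electron is passed by a spin
  flip.\<close>

lemma fsign_flip:
  assumes "s \<in> {0,1}" "r \<in> {0,1}" "s \<noteq> r" "orb x r \<notin> S"
  shows "fsign (S - {orb x s}) (orb x s) * fsign (S - {orb x s}) (orb x r) = 1"
proof -
  have "{j \<in> S - {orb x s}. j < orb x s} = {j \<in> S - {orb x s}. j < orb x r}"
  proof (intro set_eqI)
    fix j
    obtain y q where jq: "j = orb y q" "q \<in> {0,1::nat}" by (rule orb_cases)
    have "j < orb x s \<longleftrightarrow> j < orb x r" if "j \<in> S - {orb x s}"
    proof -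
      have "y \<noteq> x" using that jq assms by auto
      then show ?thesis using jq assms(1,2) by (auto simp: orb_def)
    qed
    then show "j \<in> {j \<in> S - {orb x s}. j < orb x s} \<longleftrightarrow> j \<in> {j \<in> S - {orb x s}. j < orb x r}" by blast
  qed
  then have "fsign (S - {orb x s}) (orb x s) = fsign (S - {orb x s}) (orb x r)"
    unfolding fsign_def by (simp only:)
  then show ?thesis by (simp add: fsign_mult_self)
qed

lemma card_spin:
  assumes "S \<in> Conf Ns Ne"
  shows "card {x. x < Ns \<and> orb x 1 \<in> S} = ndown S" "card {x. x < Ns \<and> orb x 0 \<in> S} + ndown S = Ne"
proof -
  have im: "card {x. x < Ns \<and> orb x s \<in> S} = card {k \<in> S. odd k \<longleftrightarrow> s = 1}" if s: "s \<in> {0,1}" for s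
  proof -
    have "{k \<in> S. odd k \<longleftrightarrow> s = 1} = (\<lambda>x. orb x s) ` {x. x < Ns \<and> orb x s \<in> S}"
    proof (rule set_eq_orbI)
      fix x r :: nat assume r: "r \<in> {0,1}"
      have "orb x r \<in> (\<lambda>x. orb x s) ` {x. x < Ns \<and> orb x s \<in> S} \<longleftrightarrow> r = s \<and> x < Ns \<and> orb x s \<in> S"
        unfolding image_iff using orb_eq_iff[OF r s] by auto
      moreover have "(odd (orb x r) \<longleftrightarrow> s = 1) \<longleftrightarrow> r = s" using odd_orb[OF r, of x] r s by auto
      moreover have "orb x s \<in> S \<Longrightarrow> x < Ns" using assms orb_less_iff[OF s, of x Ns] unfolding Conf_def by blast
      ultimately show "orb x r \<in> {k \<in> S. odd k \<longleftrightarrow> s = 1} \<longleftrightarrow>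
          orb x r \<in> (\<lambda>x. orb x s) ` {x. x < Ns \<and> orb x s \<in> S}" by blast
    qed
    then show ?thesis by (simp add: card_image inj_on_def orb_def)
  qed
  show 1: "card {x. x < Ns \<and> orb x 1 \<in> S} = ndown S" using im[of 1] by (simp add: ndown_def)
  have "card S = card ({k \<in> S. even k} \<union> {k \<in> S. odd k})" by (rule arg_cong[where f = card]) auto
  also have "\<dots> = card {k \<in> S. even k} + card {k \<in> S. odd k}"
    by (rule card_Un_disjoint) (use Conf_finite[OF assms] in auto)
  finally show "card {x. x < Ns \<and> orb x 0 \<in> S} + ndown S = Ne"
    using im[of 0] assms by (simp add: ndown_def Conf_def)
qed

lemma ndown_le: "S \<in> Conf Ns Ne \<Longrightarrow> ndown S \<le> Ne"
  using card_spin(2) by (metis le_add2)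

text \<open>The number of electrons of spin \<open>s\<close> when \<open>m\<close> of them are down,
  as a polynomial in \<open>m\<close>; identities between spin operators then hold for every integer
  \<open>m\<close>, also outside 0, ..., \<open>Ne\<close>.\<close>

definition spin_occ :: "nat \<Rightarrow> nat \<Rightarrow> int \<Rightarrow> complex" where
  "spin_occ Ne s m = (if s = 0 then of_nat Ne - of_int m else of_int m)"

text \<open>The action of the spin operators on the amplitudes \<open>g\<close> of \<open>ferro_state\<close> below.  The number of down
  spins is an integer here, so that lowering it at \<open>0\<close> is not truncated (the factor vanishes).\<close>

definition spin_op :: "nat \<Rightarrow> nat \<Rightarrow> (int \<Rightarrow> complex) \<Rightarrow> int \<Rightarrow> complex" where
  "spin_op Ne a g m = 1/2 * (\<Sum>s\<in>{0,1}. \<Sum>r\<in>{0,1}. pauli a s r * spin_occ Ne s m * g (m + int r - int s))"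

text \<open>Shifts of \<open>m\<close> by two cancel between components 1 and 2. These contribute
  the mean of \<open>(Ne - m) (m + 1)\<close> and \<open>m (Ne - m + 1)\<close>, component 3 the
  square of \<open>Ne / 2 - m\<close>, and the dependence on \<open>m\<close> drops out of the
  sum.\<close>

lemma spin_op_casimir:
  "(\<Sum>a\<in>{1,2,3}. spin_op Ne a (spin_op Ne a g) m) = of_real (real Ne / 2 * (real Ne / 2 + 1)) * g m"
  by (simp add: spin_op_def pauli_def spin_occ_def field_simps)

lemma sum_spin_occ:
  assumes "S \<in> Conf Ns Ne" "s \<in> {0,1}"
  shows "(\<Sum>x<Ns. if orb x s \<in> S then c else 0) = spin_occ Ne s (int (ndown S)) * c"
proof -
  have "(\<Sum>x<Ns. if orb x s \<in> S then c else 0) = of_nat (card {x. x < Ns \<and> orb x s \<in> S}) * c"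
    by (simp add: sum.If_cases Int_def)
  moreover have "of_nat (card {x. x < Ns \<and> orb x s \<in> S}) = spin_occ Ne s (int (ndown S))"
  proof (cases "s = 0")
    case True
    have "(of_nat (card {x. x < Ns \<and> orb x 0 \<in> S}) :: complex) + of_nat (ndown S) = of_nat Ne"
      using card_spin(2)[OF assms(1)] by (metis of_nat_add)
    then show ?thesis using True unfolding spin_occ_def by (simp add: algebra_simps)
  next
    case False
    then show ?thesis using assms(2) card_spin(1)[OF assms(1)] unfolding spin_occ_def by simp
  qed
  ultimately show ?thesis by simp
qed

definition ferro_state :: "nat \<Rightarrow> nat \<Rightarrow> (nat set \<Rightarrow> real) \<Rightarrow> (int \<Rightarrow> complex) \<Rightarrow> state" where
  "ferro_state Ns Ne \<phi> g S = (if S \<in> Conf Ns Ne then g (int (ndown S)) * of_real (\<phi> (polarize S)) else 0)"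

lemma ferro_state_Vspace: "ferro_state Ns Ne \<phi> g \<in> Vspace Ns Ne"
  unfolding Vspace_iff ferro_state_def by simp

text \<open>The amplitude comes from the configuration with the spin at \<open>x\<close> flipped
  from \<open>s\<close> to \<open>r\<close>: same sites, hence the same \<open>\<phi>\<close>, no
  sign, and \<open>r - s\<close> more down spins. Outside \<open>Conf\<close> both sides vanish,
  since flipping back would otherwise lead into \<open>Conf\<close>.\<close>

lemma spin_flip_ferro_state:
  assumes "s \<in> {0,1}" "r \<in> {0,1}"
  shows "cre (orb x s) (ann (orb x r) (ferro_state Ns Ne \<phi> g)) S =
    (if orb x s \<in> S then ferro_state Ns Ne \<phi> (\<lambda>m. g (m + int r - int s)) S else 0)"
proof (cases "s = r")
  case True
  then show ?thesis using numop_apply[of "orb x r" "ferro_state Ns Ne \<phi> g" S] unfolding numop_def by simp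
next
  case sr: False
  show ?thesis
  proof (cases "orb x s \<in> S")
    case False
    then show ?thesis unfolding cre_ann_apply by simp
  next
    case s: True
    show ?thesis
    proof (cases "S \<in> Conf Ns Ne")
      case True
      note f = Conf_flip[OF assms sr s True]
      have "polarize (flip x s r S) = polarize S"
        unfolding polarize_def sites_flip[OF assms s Conf_no_double[OF True]] ..
      moreover have "orb x r \<notin> S - {orb x s}" using f(1) by simp
      ultimately show ?thesis
        using s True f fsign_flip[OF assms sr f(1)]
        unfolding cre_ann_apply flip_def[symmetric] ferro_state_def by simp
    next
      case False
      have "flip x s r S \<notin> Conf Ns Ne" if "orb x r \<notin> S"
      proof
        assume *: "flip x s r S \<in> Conf Ns Ne"
        have "orb x r \<in> flip x s r S" unfolding flip_def by simp
        from Conf_flip(2)[OF assms(2,1) _ this *] show False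
          using flip_inverse[OF s that] sr False by simp
      qed
      moreover have "orb x r \<in> S - {orb x s}" if "orb x r \<in> S"
        using that sr assms by simp
      ultimately show ?thesis
        using False unfolding cre_ann_apply flip_def[symmetric] ferro_state_def by auto
    qed
  qed
qed

text \<open>The term at \<open>x\<close> depends on \<open>x\<close> only through whether the site
  carries spin \<open>s\<close>, so the sum over sites merely counts these and yields
  \<open>spin_occ\<close>.\<close>

lemma Stot_ferro_state: "Stot Ns a (ferro_state Ns Ne \<phi> g) = ferro_state Ns Ne \<phi> (spin_op Ne a g)"
proof
  fix S
  have "Stot Ns a (ferro_state Ns Ne \<phi> g) S = 1/2 * (\<Sum>x<Ns. \<Sum>s\<in>{0,1}. \<Sum>r\<in>{0,1}.
      pauli a s r * cre (orb x s) (ann (orb x r) (ferro_state Ns Ne \<phi> g)) S)"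
    unfolding Stot_def smul_def sum_fun_apply ..
  also have "\<dots> = 1/2 * (\<Sum>x<Ns. \<Sum>s\<in>{0,1}. \<Sum>r\<in>{0,1}.
      if orb x s \<in> S then pauli a s r * ferro_state Ns Ne \<phi> (\<lambda>m. g (m + int r - int s)) S else 0)"
    by (intro arg_cong[where f = "(*) (1/2)"] sum.cong refl) (subst spin_flip_ferro_state, assumption, assumption, simp)
  also have "\<dots> = 1/2 * (\<Sum>s\<in>{0,1}. \<Sum>r\<in>{0,1}. \<Sum>x<Ns.
      if orb x s \<in> S then pauli a s r * ferro_state Ns Ne \<phi> (\<lambda>m. g (m + int r - int s)) S else 0)"
    by (simp only: sum.swap[of _ _ "{..<Ns}"])
  also have "\<dots> = ferro_state Ns Ne \<phi> (spin_op Ne a g) S"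
  proof (cases "S \<in> Conf Ns Ne")
    case True
    have "(\<Sum>s\<in>{0,1}. \<Sum>r\<in>{0,1}. \<Sum>x<Ns.
        if orb x s \<in> S then pauli a s r * ferro_state Ns Ne \<phi> (\<lambda>m. g (m + int r - int s)) S else 0)
      = (\<Sum>s\<in>{0,1}. \<Sum>r\<in>{0,1}. pauli a s r * spin_occ Ne s (int (ndown S))
          * g (int (ndown S) + int r - int s)) * of_real (\<phi> (polarize S))"
      unfolding sum_distrib_right
      by (intro sum.cong refl) (subst sum_spin_occ[OF True], assumption, simp add: ferro_state_def True)
    then show ?thesis using True unfolding ferro_state_def spin_op_def by simp
  next
    case False
    then have z: "ferro_state Ns Ne \<phi> h S = 0" for h by (simp add: ferro_state_def)
    show ?thesis unfolding z mult_zero_right if_cancel by simp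
  qed
  finally show "Stot Ns a (ferro_state Ns Ne \<phi> g) S = ferro_state Ns Ne \<phi> (spin_op Ne a g) S" .
qed

lemma Stot_sq_ferro_state:
  "Stot_sq Ns (ferro_state Ns Ne \<phi> g) = smul (of_real (real Ne / 2 * (real Ne / 2 + 1))) (ferro_state Ns Ne \<phi> g)"
proof
  fix S
  have "Stot_sq Ns (ferro_state Ns Ne \<phi> g) S = (\<Sum>a\<in>{1,2,3}. ferro_state Ns Ne \<phi> (spin_op Ne a (spin_op Ne a g)) S)"
    unfolding Stot_sq_def Stot_ferro_state sum_fun_apply ..
  also have "\<dots> = ferro_state Ns Ne \<phi> (\<lambda>m. \<Sum>a\<in>{1,2,3}. spin_op Ne a (spin_op Ne a g) m) S"
    unfolding ferro_state_def by (simp add: algebra_simps)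
  finally show "Stot_sq Ns (ferro_state Ns Ne \<phi> g) S
      = smul (of_real (real Ne / 2 * (real Ne / 2 + 1))) (ferro_state Ns Ne \<phi> g) S"
    unfolding spin_op_casimir by (simp add: ferro_state_def smul_def)
qed

section \<open>Perron-Frobenius on the sectors and the ground states\<close>

context hubbard_ring
begin

definition sector :: "nat \<Rightarrow> nat set set" where
  "sector M = {S \<in> Conf Ns Ne. ndown S = M}"

lemma finite_sector: "finite (sector M)"
  unfolding sector_def using finite_Conf by simp

lemma sector_move:
  assumes "S \<in> sector M" "b < Ns" "s \<in> {0,1}" "orb a s \<in> S" "b \<notin> sites S"
  shows "move a s b S \<in> sector M"
  using assms Conf_move[of S Ns Ne s a b] ndown_move[of S s a b] Conf_finite[of S Ns Ne]
  unfolding sector_def by simp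

lemma sector_nonempty:
  assumes "M \<le> Ne"
  shows "sector M \<noteq> {}"
proof -
  define L where "L = map Some (replicate M 1 @ replicate (Ne - M) 0) @ replicate (Ns - Ne) (None :: nat option)"
  have L: "somes L = replicate M 1 @ replicate (Ne - M) 0" "length L = Ns"
    using assms Ne_less unfolding L_def by (simp_all del: map_append)
  have b: "set (somes L) \<subseteq> {0,1}" unfolding L(1) by auto
  then have "valid L" using assms L unfolding valid_def by simp
  moreover have "ndown (config L) = M" using ndown_config[OF b] L by simp
  ultimately have "config L \<in> sector M" using config_Conf unfolding sector_def by simp
  then show ?thesis by blast
qed

lemma hop_matrix_pos_ndown:
  assumes "S \<in> Conf Ns Ne" "hop_matrix S S' > 0"
  shows "ndown S' = ndown S"
proof (rule ccontr)
  assume *: "ndown S' \<noteq> ndown S"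
  have "hop_matrix S S' = 0"
    unfolding hop_matrix_def
  proof (intro sum.neutral ballI)
    fix a b s :: nat assume "s \<in> {0,1}"
    then have "\<not> (orb a s \<in> S \<and> b \<notin> sites S \<and> S' = move a s b S)"
      using ndown_move[OF Conf_finite[OF assms(1)], of s a b] * by blast
    then show "hop_amp (sites S) a b * of_bool (orb a s \<in> S \<and> b \<notin> sites S \<and> S' = move a s b S) = 0"
      by (simp only: of_bool_eq mult_zero_right)
  qed
  then show False using assms(2) by simp
qed

lemma sector_irreducible: "irreducible_symmetric_matrix (sector M) hop_matrix"
proof
  fix P :: "nat set \<Rightarrow> bool" and X Y
  assume inv: "\<And>X Y. X \<in> sector M \<Longrightarrow> Y \<in> sector M \<Longrightarrow> 0 < hop_matrix X Y \<Longrightarrow> P X = P Y"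
    and XY: "X \<in> sector M" "Y \<in> sector M"
  have "(ndown X = M \<and> P X) = (ndown Y = M \<and> P Y)"
  \<comment> \<open>The property is only known to be preserved inside the sector. The conjunct
    \<open>ndown S = M\<close> makes it false elsewhere, and positive entries never change
    \<open>ndown\<close>, so it is preserved on all of \<open>Conf\<close>.\<close>
  proof (rule invariant_on_sector[where P = "\<lambda>S. ndown S = M \<and> P S"])
    fix S S' assume "S \<in> Conf Ns Ne" "S' \<in> Conf Ns Ne" "0 < hop_matrix S S'"
    then show "(ndown S = M \<and> P S) = (ndown S' = M \<and> P S')"
      using inv[of S S'] hop_matrix_pos_ndown[of S S'] unfolding sector_def by auto
  qed (use XY in \<open>auto simp: sector_def\<close>)
  then show "P X = P Y" using XY unfolding sector_def by simp
qed (auto simp: finite_Conf hop_matrix_nonneg sector_def intro!: hop_matrix_sym Conf_no_double)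

lemma hop_matrix_sum_sector:
  fixes h :: "nat set \<Rightarrow> 'v::real_vector"
  assumes "S \<in> sector M"
  shows "(\<Sum>S'\<in>sector M. hop_matrix S S' *\<^sub>R h S') = (\<Sum>a<Ns. \<Sum>b<Ns. hop_amp (sites S) a b *\<^sub>R hop_sum h S a b)"
  by (rule hop_matrix_sum[OF finite_sector]) (rule sector_move[OF assms])

lemma polarize_sector: "S \<in> Conf Ns Ne \<Longrightarrow> polarize S \<in> sector 0"
  unfolding sector_def using Conf_polarize ndown_polarize by simp

text \<open>At most one spin is present at \<open>a\<close>, so the sum over spins has at most one
  nonzero term. The result mentions sites only, which allows \<open>S\<close> and
  \<open>polarize S\<close> to be compared.\<close>

lemma hop_sum_eq_if_spin_independent:
  assumes "no_double S"
    and h: "\<And>s. s \<in> {0,1} \<Longrightarrow> orb a s \<in> S \<Longrightarrow> b \<notin> sites S \<Longrightarrow> h (move a s b S) = v"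
  shows "hop_sum h S a b = (if a \<in> sites S \<and> b \<notin> sites S then v else 0)"
proof (cases "a \<in> sites S \<and> b \<notin> sites S")
  case True
  then obtain s where s: "s \<in> {0,1}" "orb a s \<in> S" unfolding sites_iff by blast
  have "hop_sum h S a b = (\<Sum>r\<in>{0,1}. if r = s then v else 0)"
    unfolding hop_sum_def
  proof (rule sum.cong[OF refl])
    fix r :: nat assume r: "r \<in> {0,1}"
    show "(if orb a r \<in> S \<and> b \<notin> sites S then h (move a r b S) else 0) = (if r = s then v else 0)"
    proof (cases "r = s")
      case rs: True
      then show ?thesis using h[OF s] s(2) True by simp
    next
      case False
      then have "orb a r \<notin> S" using no_doubleD[OF assms(1) _ s(2) r s(1)] by blast
      then show ?thesis using False by simp
    qed
  qed
  also have "\<dots> = v" using s(1) by (subst sum.delta) auto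
  finally show ?thesis using True by simp
next
  case False
  have "hop_sum h S a b = 0"
    unfolding hop_sum_def
  proof (intro sum.neutral ballI)
    fix s :: nat assume "s \<in> {0,1}"
    then have "\<not> (orb a s \<in> S \<and> b \<notin> sites S)" using False orb_in_sites by blast
    then show "(if orb a s \<in> S \<and> b \<notin> sites S then h (move a s b S) else 0) = 0" by (rule if_not_P)
  qed
  then show ?thesis by (simp only: if_not_P[OF False])
qed

lemma hop_sum_ferro_state:
  assumes "S \<in> Conf Ns Ne" "b < Ns"
  shows "hop_sum (ferro_state Ns Ne \<phi> g) S a b = g (int (ndown S)) * of_real (hop_sum \<phi> (polarize S) a b)"
proof -
  note nd = Conf_no_double[OF assms(1)]
  have 1: "hop_sum (ferro_state Ns Ne \<phi> g) S a b = (if a \<in> sites S \<and> b \<notin> sites S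
      then g (int (ndown S)) * of_real (\<phi> (move a 0 b (polarize S))) else 0)"
    by (rule hop_sum_eq_if_spin_independent[OF nd])
      (simp add: ferro_state_def Conf_move assms ndown_move[OF Conf_finite[OF assms(1)]] polarize_move[OF nd])
  have 2: "hop_sum \<phi> (polarize S) a b = (if a \<in> sites S \<and> b \<notin> sites S then \<phi> (move a 0 b (polarize S)) else 0)"
    unfolding sites_polarize[of S, symmetric]
    by (rule hop_sum_eq_if_spin_independent[OF no_double_polarize]) (simp only: orb_in_polarize)
  show ?thesis unfolding 1 2 by simp
qed

context
  fixes \<phi> :: "nat set \<Rightarrow> real" and l :: real
  assumes \<phi>_pos: "\<And>S. S \<in> sector 0 \<Longrightarrow> \<phi> S > 0"
    and \<phi>_eig: "\<And>S. S \<in> sector 0 \<Longrightarrow> (\<Sum>S'\<in>sector 0. hop_matrix S S' * \<phi> S') = l * \<phi> S"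
begin

text \<open>Amplitudes and possible hops depend on the occupied sites alone, so the sum at
  \<open>S\<close> is the one at \<open>polarize S\<close>, where \<open>\<phi>_eig\<close> applies;
  the factor \<open>g\<close> comes out because hops preserve the number of down spins.\<close>

lemma weighted_hop_sum_ferro_state:
  assumes "S \<in> Conf Ns Ne"
  shows "(\<Sum>a<Ns. \<Sum>b<Ns. hop_amp (sites S) a b *\<^sub>R hop_sum (ferro_state Ns Ne \<phi> g) S a b) = of_real l * ferro_state Ns Ne \<phi> g S"
proof -
  have "(\<Sum>a<Ns. \<Sum>b<Ns. hop_amp (sites S) a b *\<^sub>R hop_sum (ferro_state Ns Ne \<phi> g) S a b)
      = g (int (ndown S)) * of_real (\<Sum>a<Ns. \<Sum>b<Ns. hop_amp (sites (polarize S)) a b *\<^sub>R hop_sum \<phi> (polarize S) a b)"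
    unfolding of_real_sum sum_distrib_left sites_polarize
    by (intro sum.cong refl) (simp add: hop_sum_ferro_state[OF assms] scaleR_conv_of_real)
  also have "\<dots> = g (int (ndown S)) * of_real (l * \<phi> (polarize S))"
    using \<phi>_eig[OF polarize_sector[OF assms]] hop_matrix_sum_sector[OF polarize_sector[OF assms], of \<phi>] by simp
  also have "\<dots> = of_real l * ferro_state Ns Ne \<phi> g S"
    using assms unfolding ferro_state_def by simp
  finally show ?thesis .
qed

lemma Heff_ferro_state: "Heff Ns t t' (ferro_state Ns Ne \<phi> g) = smul (of_real (- l)) (ferro_state Ns Ne \<phi> g)"
proof
  fix S
  show "Heff Ns t t' (ferro_state Ns Ne \<phi> g) S = smul (of_real (- l)) (ferro_state Ns Ne \<phi> g) S"
  proof (cases "S \<in> Conf Ns Ne")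
    case True
    show ?thesis
      unfolding Heff_apply[OF ferro_state_Vspace True] weighted_hop_sum_ferro_state[OF True] smul_def by simp
  next
    case False
    show ?thesis
      unfolding Heff_outside[OF ferro_state_Vspace False] using False by (simp add: smul_def ferro_state_def)
  qed
qed

lemma polarize_eigenvector:
  assumes "S \<in> sector M"
  shows "(\<Sum>S'\<in>sector M. hop_matrix S S' * \<phi> (polarize S')) = l * \<phi> (polarize S)"
proof -
  have S: "S \<in> Conf Ns Ne" using assms unfolding sector_def by simp
  have "(\<Sum>S'\<in>sector M. hop_matrix S S' *\<^sub>R ferro_state Ns Ne \<phi> (\<lambda>_. 1) S') = of_real (l * \<phi> (polarize S))"
    using hop_matrix_sum_sector[OF assms, of "ferro_state Ns Ne \<phi> (\<lambda>_. 1)"] weighted_hop_sum_ferro_state[OF S, of "\<lambda>_. 1"] S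
    by (simp add: ferro_state_def)
  moreover have "(\<Sum>S'\<in>sector M. hop_matrix S S' *\<^sub>R ferro_state Ns Ne \<phi> (\<lambda>_. 1) S')
      = of_real (\<Sum>S'\<in>sector M. hop_matrix S S' * \<phi> (polarize S'))"
    unfolding of_real_sum
    by (intro sum.cong refl) (simp add: ferro_state_def sector_def scaleR_conv_of_real)
  ultimately show ?thesis by (metis of_real_eq_iff)
qed

text \<open>One argument serves two purposes: at \<open>E = - l\<close> it describes all ground
  states, for \<open>E < - l\<close> it excludes eigenvectors. On each sector \<open>\<psi>\<close>
  is a multiple of \<open>\<phi>\<close> read on the occupied sites, and \<open>g\<close> collects
  the factors.\<close>

lemma low_eigenvector_eq_ferro_state:
  assumes \<psi>: "\<psi> \<in> Vspace Ns Ne" "Heff Ns t t' \<psi> = smul (complex_of_real E) \<psi>" and E: "E \<le> - l"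
  obtains g where "\<psi> = ferro_state Ns Ne \<phi> g" "E < - l \<Longrightarrow> \<psi> = 0"
proof -
  have "\<exists>c. (\<forall>S\<in>sector M. \<psi> S = c * of_real (\<phi> (polarize S))) \<and> (E < - l \<longrightarrow> c = 0)" for M
  proof -
    interpret irreducible_symmetric_matrix "sector M" hop_matrix by (rule sector_irreducible)
    have eq: "(\<Sum>S'\<in>sector M. hop_matrix S S' *\<^sub>R \<psi> S') = of_real (- E) * \<psi> S" if S: "S \<in> sector M" for S
    proof -
      have "S \<in> Conf Ns Ne" using S unfolding sector_def by simp
      then show ?thesis
        using Heff_apply[OF \<psi>(1), of S] hop_matrix_sum_sector[OF S, of \<psi>] \<psi>(2)
        by (simp add: smul_def minus_equation_iff[of "_ * _"])
    qed
    \<comment> \<open>The matrix and \<open>E\<close> are real, so real and imaginary parts are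
      eigenvectors separately and the real theory applies to both.\<close>
    have re: "(\<Sum>S'\<in>sector M. hop_matrix S S' * Re (\<psi> S')) = - E * Re (\<psi> S)"
      and im: "(\<Sum>S'\<in>sector M. hop_matrix S S' * Im (\<psi> S')) = - E * Im (\<psi> S)" if "S \<in> sector M" for S
      using arg_cong[OF eq[OF that], of Re] arg_cong[OF eq[OF that], of Im] by simp_all
    have pos: "\<phi> (polarize S) > 0" if "S \<in> sector M" for S
      using that \<phi>_pos polarize_sector unfolding sector_def by blast
    have lE: "l \<le> - E" using E by simp
    obtain k where k: "\<And>S. S \<in> sector M \<Longrightarrow> Re (\<psi> S) = k * \<phi> (polarize S)" "l < - E \<Longrightarrow> k = 0"
      by (rule eigenvector_uniqueness[OF pos polarize_eigenvector re lE]) auto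
    obtain k' where k': "\<And>S. S \<in> sector M \<Longrightarrow> Im (\<psi> S) = k' * \<phi> (polarize S)" "l < - E \<Longrightarrow> k' = 0"
      by (rule eigenvector_uniqueness[OF pos polarize_eigenvector im lE]) auto
    have "\<forall>S\<in>sector M. \<psi> S = Complex k k' * of_real (\<phi> (polarize S))"
      using k(1) k'(1) by (simp add: complex_eq_iff)
    moreover have "E < - l \<longrightarrow> Complex k k' = 0"
      using k(2) k'(2) by (simp add: complex_eq_iff)
    ultimately show ?thesis by blast
  qed
  then obtain c where c: "\<And>M. (\<forall>S\<in>sector M. \<psi> S = c M * of_real (\<phi> (polarize S))) \<and> (E < - l \<longrightarrow> c M = 0)"
    by metis
  have eq: "\<psi> = ferro_state Ns Ne \<phi> (\<lambda>m. c (nat m))"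
  proof
    fix S
    show "\<psi> S = ferro_state Ns Ne \<phi> (\<lambda>m. c (nat m)) S"
      using c[of "ndown S"] \<psi>(1) unfolding ferro_state_def Vspace_iff sector_def by simp
  qed
  moreover have "\<psi> = 0" if "E < - l"
  proof -
    have "c M = 0" for M using c that by blast
    then show ?thesis unfolding eq by (simp add: ferro_state_def fun_eq_iff)
  qed
  ultimately show thesis using that by blast
qed

lemma eigenspace_eq: "eigenspace Ns Ne t t' (- l) = range (ferro_state Ns Ne \<phi>)"
proof (intro set_eqI iffI)
  fix \<psi> assume "\<psi> \<in> eigenspace Ns Ne t t' (- l)"
  then have "\<psi> \<in> Vspace Ns Ne" "Heff Ns t t' \<psi> = smul (complex_of_real (- l)) \<psi>"
    unfolding eigenspace_def by auto
  from low_eigenvector_eq_ferro_state[OF this] show "\<psi> \<in> range (ferro_state Ns Ne \<phi>)" by blast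
next
  fix \<psi> assume "\<psi> \<in> range (ferro_state Ns Ne \<phi>)"
  then show "\<psi> \<in> eigenspace Ns Ne t t' (- l)"
    using Heff_ferro_state ferro_state_Vspace unfolding eigenspace_def by auto
qed

text \<open>A basis is given by the ferromagnetic states living on a single sector, one for each
  number of down spins up to \<open>Ne\<close>. They have disjoint supports, and none is zero
  because every sector is nonempty and \<open>\<phi>\<close> positive.\<close>

lemma cdim_eigenspace: "cdim (eigenspace Ns Ne t t' (- l)) = Ne + 1"
proof -
  interpret vs: vector_space smul
    by unfold_locales (simp_all add: smul_def fun_eq_iff algebra_simps)
  define b where "b M = ferro_state Ns Ne \<phi> (\<lambda>m. of_bool (m = int M))" for M
  have ex: "\<exists>S. S \<in> Conf Ns Ne \<and> ndown S = M \<and> \<phi> (polarize S) > 0" if "M \<le> Ne" for M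
    using sector_nonempty[OF that] \<phi>_pos polarize_sector unfolding sector_def by blast
  have bS: "b M S = of_bool (ndown S = M) * of_real (\<phi> (polarize S))" if "S \<in> Conf Ns Ne" for M S
    using that unfolding b_def ferro_state_def by simp
  have inj: "inj_on b {..Ne}"
  proof (rule inj_onI)
    fix M M' assume M: "M \<in> {..Ne}" "M' \<in> {..Ne}" "b M = b M'"
    obtain S where S: "S \<in> Conf Ns Ne" "ndown S = M" "\<phi> (polarize S) > 0" using ex[of M] M by auto
    have "b M S = b M' S" using M(3) by simp
    then show "M = M'" using S unfolding bS[OF S(1)] by (auto split: if_splits)
  qed
  show ?thesis
    unfolding cdim_def
  proof (rule vs.dim_unique[where B = "b ` {..Ne}"])
    show "b ` {..Ne} \<subseteq> eigenspace Ns Ne t t' (- l)"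
      unfolding eigenspace_eq b_def by auto
    show "eigenspace Ns Ne t t' (- l) \<subseteq> vs.span (b ` {..Ne})"
    proof
      fix \<psi> assume "\<psi> \<in> eigenspace Ns Ne t t' (- l)"
      then obtain g where g: "\<psi> = ferro_state Ns Ne \<phi> g" unfolding eigenspace_eq by auto
      have "\<psi> = (\<Sum>M\<le>Ne. smul (g (int M)) (b M))"
      proof
        fix S
        show "\<psi> S = (\<Sum>M\<le>Ne. smul (g (int M)) (b M)) S"
        proof (cases "S \<in> Conf Ns Ne")
          case True
          have "(\<Sum>M\<le>Ne. smul (g (int M)) (b M)) S
              = (\<Sum>M\<le>Ne. if M = ndown S then g (int M) * of_real (\<phi> (polarize S)) else 0)"
            unfolding sum_fun_apply smul_def by (intro sum.cong refl) (simp add: bS[OF True])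
          then show ?thesis using ndown_le[OF True] True g by (simp add: ferro_state_def)
        next
          case False
          then show ?thesis unfolding g sum_fun_apply smul_def b_def by (simp add: ferro_state_def)
        qed
      qed
      then show "\<psi> \<in> vs.span (b ` {..Ne})"
        by (simp only:) (intro vs.span_sum vs.span_scale vs.span_base imageI)
    qed
    show "vs.independent (b ` {..Ne})"
    proof (rule vs.independent_if_scalars_zero)
      fix f x assume sum0: "(\<Sum>x\<in>b ` {..Ne}. smul (f x) x) = 0" and "x \<in> b ` {..Ne}"
      then obtain M where M: "M \<le> Ne" "x = b M" by auto
      \<comment> \<open>Evaluating the linear relation at a configuration with \<open>M\<close> down
        spins isolates the coefficient of \<open>b M\<close>.\<close>
      obtain S where S: "S \<in> Conf Ns Ne" "ndown S = M" "\<phi> (polarize S) > 0" using ex[OF M(1)] by auto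
      have "0 = (\<Sum>N\<le>Ne. smul (f (b N)) (b N)) S"
        using sum0 unfolding sum.reindex[OF inj] by (simp add: comp_def)
      also have "\<dots> = (\<Sum>N\<le>Ne. if N = M then f (b N) * of_real (\<phi> (polarize S)) else 0)"
        unfolding sum_fun_apply smul_def by (intro sum.cong refl) (auto simp: bS[OF S(1)] S(2))
      also have "\<dots> = f x * of_real (\<phi> (polarize S))" using M by simp
      finally show "f x = 0" using S(3) by simp
    qed simp
    show "card (b ` {..Ne}) = Ne + 1" using card_image[OF inj] by simp
  qed
qed

end

end

theorem mainTheorem10:
  fixes Ns Ne :: nat and t t' :: real
  assumes "even Ns" and "t > 0" and "t' > 0" and "odd Ne" and "Ne < Ns"
  shows "\<exists>E0. is_eigenvalue Ns Ne t t' E0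
           \<and> (\<forall>E. is_eigenvalue Ns Ne t t' E \<longrightarrow> E0 \<le> E)
           \<and> cdim (eigenspace Ns Ne t t' E0) = Ne + 1
           \<and> (\<forall>\<psi>\<in>eigenspace Ns Ne t t' E0.
                Stot_sq Ns \<psi> = smul (complex_of_real ((real Ne / 2) * (real Ne / 2 + 1))) \<psi>)"
proof -
  interpret hubbard_ring Ns Ne t t' by unfold_locales (fact assms)+
  interpret irreducible_symmetric_matrix "sector 0" hop_matrix by (rule sector_irreducible)
  obtain \<phi> l where \<phi>: "\<And>S. S \<in> sector 0 \<Longrightarrow> \<phi> S > 0"
      "\<And>S. S \<in> sector 0 \<Longrightarrow> (\<Sum>S'\<in>sector 0. hop_matrix S S' * \<phi> S') = l * \<phi> S"
    by (rule positive_eigenvector_exists[OF sector_nonempty[OF le0]]) blast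
  show ?thesis
  proof (intro exI[of _ "- l"] conjI allI impI ballI)
    obtain S where S: "S \<in> sector 0" using sector_nonempty[of 0] by auto
    then have "ferro_state Ns Ne \<phi> (\<lambda>_. 1) S \<noteq> 0"
      using \<phi>(1)[OF polarize_sector[of S]] unfolding ferro_state_def sector_def by simp
    then have "ferro_state Ns Ne \<phi> (\<lambda>_. 1) \<noteq> 0" by auto
    then show "is_eigenvalue Ns Ne t t' (- l)"
      unfolding is_eigenvalue_def using Heff_ferro_state[OF \<phi>] ferro_state_Vspace by blast
    show "- l \<le> E" if ev: "is_eigenvalue Ns Ne t t' E" for E
    proof (rule ccontr)
      assume "\<not> - l \<le> E"
      then have E: "E < - l" by simp
      obtain \<psi> where \<psi>: "\<psi> \<in> Vspace Ns Ne" "\<psi> \<noteq> 0" "Heff Ns t t' \<psi> = smul (complex_of_real E) \<psi>"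
        using ev unfolding is_eigenvalue_def by auto
      show False
        using low_eigenvector_eq_ferro_state[OF \<phi> \<psi>(1,3) less_imp_le[OF E]] E \<psi>(2) by blast
    qed
    show "cdim (eigenspace Ns Ne t t' (- l)) = Ne + 1" by (rule cdim_eigenspace[OF \<phi>])
    show "Stot_sq Ns \<psi> = smul (complex_of_real (real Ne / 2 * (real Ne / 2 + 1))) \<psi>"
      if \<psi>: "\<psi> \<in> eigenspace Ns Ne t t' (- l)" for \<psi>
    proof -
      obtain g where "\<psi> = ferro_state Ns Ne \<phi> g" using \<psi> eigenspace_eq[OF \<phi>] by auto
      then show ?thesis by (simp only: Stot_sq_ferro_state)
    qed
  qed
qed

end
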